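(* Let $1\le k<n$ be integers and let $0<\alpha\le k$ be a real number. Suppose that $B\subset\mathbb{R}^n$, $\emptyset\ne E\subset A(n,k)$, and that $\dim(P\cap B)\ge\alpha$ for every $k$-dimensional affine subspace $P\in E$. Then $$\dim B\ge 2\alpha-k+\min(\dim E,1).$$
   Context: $\dim$ denotes Hausdorff dimension. $A(n,k)$ denotes the space of all $k$-dimensional affine subspaces of $\mathbb{R}^n$. The Hausdorff dimension of a subset $E\subset A(n,k)$ is taken with respect to any natural metric $\rho$ on $A(n,k)$. Here $\rho$ is natural if it is strongly equivalent to the following metric $d$: write $P=V+a$, $P'=V'+a'$ with $V,V'$ $k$-dimensional linear subspaces, $a\in V^\perp$, $a'\in V'^\perp$, and put $d(P,P')=\|\pi_V-\pi_{V'}\|+|a-a'|$, where $\pi_V$ is the orthogonal projection onto $V$ and $\|\cdot\|$ is the operator norm; strongly equivalent means that there are constants $K_1,K_2>0$ with $K_1 d(P,P')\le\rho(P,P')\le K_2 d(P,P')$ for all $P,P'\in A(n,k)$. No measurability of $E$ or $B$ is assumed. *)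

theory Defs
  imports "HOL-Analysis.Analysis"
begin

section \<open>Hausdorff measures and Hausdorff dimension\<close>

definition ediam :: "'a metric \<Rightarrow> 'a set \<Rightarrow> ennreal" where
  "ediam m U = (SUP x\<in>U. SUP y\<in>U. ennreal (mdist m x y))"

text \<open>
  The gauge \<open>(diam U)\<^sup>s\<close>, used for \<open>s \<ge> 0\<close> and sets of finite diameter. The empty set contributes
  \<open>0\<close> for every \<open>s\<close>, and a nonempty set contributes \<open>1\<close> for \<open>s = 0\<close>, even if it is a single
  point. The case distinction is needed because \<open>0 powr 0 = 0\<close>.
\<close>

definition diam_gauge :: "'a metric \<Rightarrow> real \<Rightarrow> 'a set \<Rightarrow> ennreal" where
  "diam_gauge m s U =
     (if U = {} then 0
      else if s = 0 then 1
      else ennreal (enn2real (ediam m U) powr s))"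

definition hausdorff_premeasure :: "'a metric \<Rightarrow> real \<Rightarrow> real \<Rightarrow> 'a set \<Rightarrow> ennreal" where
  "hausdorff_premeasure m s \<delta> A =
     (INF U \<in> {U :: nat \<Rightarrow> 'a set. A \<subseteq> (\<Union>i. U i) \<and>
                 (\<forall>i. U i \<subseteq> mspace m \<and> ediam m (U i) \<le> ennreal \<delta>)}.
        \<Sum>i. diam_gauge m s (U i))"

definition hausdorff_measure :: "'a metric \<Rightarrow> real \<Rightarrow> 'a set \<Rightarrow> ennreal" where
  "hausdorff_measure m s A = (SUP \<delta>\<in>{0<..}. hausdorff_premeasure m s \<delta> A)"

text \<open>
  The value is \<open>\<infinity>\<close> if no \<open>s\<close>-dimensional Hausdorff measure of \<open>A\<close> vanishes; the
  dimension of the empty set is \<open>0\<close>.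
\<close>

definition hausdorff_dim :: "'a metric \<Rightarrow> 'a set \<Rightarrow> ereal" where
  "hausdorff_dim m A = (INF s\<in>{s. 0 \<le> s \<and> hausdorff_measure m s A = 0}. ereal s)"


section \<open>The affine Grassmannian and its natural metrics\<close>

definition affine_grassmannian :: "nat \<Rightarrow> 'a::euclidean_space set set" where
  "affine_grassmannian k = {P. affine P \<and> aff_dim P = int k}"

definition orth_proj :: "'a::euclidean_space set \<Rightarrow> 'a \<Rightarrow> 'a" where
  "orth_proj V x = (THE y. y \<in> V \<and> x - y \<in> orthogonal_comp V)"

text \<open>
  For a nonempty affine subspace \<open>P\<close>, the linear subspace \<open>V\<close> and the vector \<open>a\<close> orthogonal to
  \<open>V\<close> with \<open>P = V + a\<close>. Both are unique.
\<close>

definition affine_direction :: "'a::euclidean_space set \<Rightarrow> 'a set" where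
  "affine_direction P = (THE V. subspace V \<and> affine_parallel P V)"

definition affine_offset :: "'a::euclidean_space set \<Rightarrow> 'a" where
  "affine_offset P =
     (THE a. a \<in> orthogonal_comp (affine_direction P) \<and> P = (+) a ` affine_direction P)"

definition grassmann_dist :: "'a::euclidean_space set \<Rightarrow> 'a set \<Rightarrow> real" where
  "grassmann_dist P P' =
     onorm (\<lambda>x. orth_proj (affine_direction P) x - orth_proj (affine_direction P') x)
     + norm (affine_offset P - affine_offset P')"

definition natural_metric :: "nat \<Rightarrow> 'a::euclidean_space set metric \<Rightarrow> bool" where
  "natural_metric k \<rho> \<longleftrightarrow>
     mspace \<rho> = affine_grassmannian k \<and>
     (\<exists>K1>0. \<exists>K2>0. \<forall>P\<in>affine_grassmannian k. \<forall>P'\<in>affine_grassmannian k.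
        K1 * grassmann_dist P P' \<le> mdist \<rho> P P' \<and>
        mdist \<rho> P P' \<le> K2 * grassmann_dist P P')"


subsection \<open>Well-definedness\<close>

lemma orthogonal_comp_self_eq_0:
  "x \<in> V \<Longrightarrow> x \<in> orthogonal_comp V \<Longrightarrow> x = 0"
  using orthogonal_self by (auto simp: orthogonal_comp_def)

lemma orth_proj_unique:
  fixes V :: "'a::euclidean_space set"
  assumes "subspace V" "y \<in> V" "x - y \<in> orthogonal_comp V"
  shows "orth_proj V x = y"
  unfolding orth_proj_def
proof (rule the_equality)
  fix z assume z: "z \<in> V \<and> x - z \<in> orthogonal_comp V"
  have "y - z \<in> V" using assms z by (simp add: subspace_diff)
  moreover have "(x - z) - (x - y) \<in> orthogonal_comp V"
    using assms z subspace_diff subspace_orthogonal_comp by blast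
  ultimately show "z = y"
    using orthogonal_comp_self_eq_0[of "y - z" V] by simp
qed (use assms in auto)

lemma orth_proj_works:
  fixes V :: "'a::euclidean_space set"
  assumes "subspace V"
  shows "orth_proj V x \<in> V" "x - orth_proj V x \<in> orthogonal_comp V"
proof -
  have "x \<in> V + orthogonal_comp V"
    using subspace_sum_orthogonal_comp[OF assms] by simp
  then obtain y z where "y \<in> V" "z \<in> orthogonal_comp V" "x = y + z"
    by (auto elim: set_plus_elim)
  moreover from this have "orth_proj V x = y"
    using assms by (intro orth_proj_unique) auto
  ultimately show "orth_proj V x \<in> V" "x - orth_proj V x \<in> orthogonal_comp V" by auto
qed

lemma linear_orth_proj:
  fixes V :: "'a::euclidean_space set"
  assumes "subspace V"
  shows "linear (orth_proj V)"
proof (rule linearI)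
  note w = orth_proj_works[OF assms] and sc = subspace_orthogonal_comp[of V]
  show "orth_proj V (x + y) = orth_proj V x + orth_proj V y" for x y
    using assms w subspace_add[OF sc w(2)[of x] w(2)[of y]]
    by (intro orth_proj_unique) (auto simp: subspace_add algebra_simps)
  show "orth_proj V (c *\<^sub>R x) = c *\<^sub>R orth_proj V x" for c x
    using assms w subspace_scale[OF sc w(2)[of x], of c]
    by (intro orth_proj_unique) (auto simp: subspace_scale algebra_simps)
qed

lemma affine_direction_eq:
  fixes V :: "'a::euclidean_space set"
  assumes "subspace V"
  shows "affine_direction ((+) a ` V) = V"
proof -
  let ?P = "(+) a ` V"
  have "affine ?P" "?P \<noteq> {}"
    using assms subspace_imp_affine affine_translation subspace_0 by blast+
  moreover have "affine_parallel ?P V"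
    using affine_parallel_commute affine_parallel_def by blast
  ultimately show ?thesis
    unfolding affine_direction_def
    using affine_parallel_subspace[of ?P] assms by (metis (mono_tags, lifting) the_equality)
qed

lemma affine_offset_eq:
  fixes V :: "'a::euclidean_space set"
  assumes V: "subspace V" and a: "a \<in> orthogonal_comp V"
  shows "affine_offset ((+) a ` V) = a"
  unfolding affine_offset_def affine_direction_eq[OF V]
proof (rule the_equality)
  fix b assume b: "b \<in> orthogonal_comp V \<and> (+) a ` V = (+) b ` V"
  have "a \<in> (+) a ` V" using subspace_0[OF V] by force
  then have "a - b \<in> V" using b by auto
  moreover have "a - b \<in> orthogonal_comp V"
    using a b subspace_diff subspace_orthogonal_comp by blast
  ultimately show "b = a" using orthogonal_comp_self_eq_0[of "a - b" V] by simp
qed (use a in auto)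

lemma grassmann_dist_eq:
  fixes V V' :: "'a::euclidean_space set"
  assumes "subspace V" "a \<in> orthogonal_comp V" "subspace V'" "a' \<in> orthogonal_comp V'"
  shows "grassmann_dist ((+) a ` V) ((+) a' ` V') =
           onorm (\<lambda>x. orth_proj V x - orth_proj V' x) + norm (a - a')"
  by (simp add: grassmann_dist_def affine_direction_eq affine_offset_eq assms)

lemma affine_grassmannian_decomp:
  fixes P :: "'a::euclidean_space set"
  shows "P \<in> affine_grassmannian k \<longleftrightarrow>
     (\<exists>V a. subspace V \<and> dim V = k \<and> a \<in> orthogonal_comp V \<and> P = (+) a ` V)"
proof
  assume "P \<in> affine_grassmannian k"
  then have P: "affine P" "aff_dim P = int k" by (auto simp: affine_grassmannian_def)
  then have "P \<noteq> {}" by (auto simp: aff_dim_empty)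
  then obtain p where p: "p \<in> P" by blast
  define V where "V = (\<lambda>x. -p + x) ` P"
  have V: "subspace V" using affine_diffs_subspace[OF P(1) p] by (simp add: V_def)
  have PV: "P = (+) p ` V" by (auto simp: V_def image_image)
  have "int (dim V) = aff_dim V" using aff_dim_subspace[OF V] by simp
  also have "\<dots> = aff_dim P" unfolding PV by (simp only: aff_dim_translation_eq)
  finally have "dim V = k" using P by simp
  define a where "a = p - orth_proj V p"
  have "P = (+) a ` V"
  proof -
    have q: "orth_proj V p \<in> V" by (rule orth_proj_works(1)[OF V])
    have "(+) (orth_proj V p) ` V = V"
    proof (intro equalityI subsetI)
      fix v assume "v \<in> V"
      then show "v \<in> (+) (orth_proj V p) ` V"
        using q V by (intro image_eqI[of _ _ "v - orth_proj V p"]) (auto simp: subspace_diff)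
    qed (use q V in \<open>auto simp: subspace_add\<close>)
    then have "(+) a ` V = (+) a ` (+) (orth_proj V p) ` V" by simp
    also have "\<dots> = P" by (simp add: PV image_image a_def flip: add.assoc)
    finally show ?thesis by simp
  qed
  with V \<open>dim V = k\<close> orth_proj_works(2)[OF V, of p]
  show "\<exists>V a. subspace V \<and> dim V = k \<and> a \<in> orthogonal_comp V \<and> P = (+) a ` V"
    unfolding a_def by blast
next
  assume "\<exists>V a. subspace V \<and> dim V = k \<and> a \<in> orthogonal_comp V \<and> P = (+) a ` V"
  then show "P \<in> affine_grassmannian k"
    by (auto simp: affine_grassmannian_def aff_dim_translation_eq aff_dim_subspace
        simp flip: affine_translation intro: subspace_imp_affine)
qed

lemma Metric_space_grassmann_dist:
  "Metric_space (affine_grassmannian k :: 'a::euclidean_space set set)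
     (\<lambda>P Q. if P \<in> affine_grassmannian k \<and> Q \<in> affine_grassmannian k
             then grassmann_dist P Q else 0)"
proof -
  let ?G = "affine_grassmannian k :: 'a set set"
  define pr where "pr P = orth_proj (affine_direction P)" for P :: "'a set"
  have dec: "subspace (affine_direction P) \<and> P = (+) (affine_offset P) ` affine_direction P"
    if "P \<in> ?G" for P
    using that unfolding affine_grassmannian_decomp
    by (auto simp: affine_direction_eq affine_offset_eq)
  have lin: "bounded_linear (pr P)" if "P \<in> ?G" for P
    using dec[OF that] linear_orth_proj by (auto simp: pr_def linear_linear)
  have bl: "bounded_linear (\<lambda>x. pr P x - pr Q x)" if "P \<in> ?G" "Q \<in> ?G" for P Q
    using lin that by (intro bounded_linear_sub)
  have d: "grassmann_dist P Q = onorm (\<lambda>x. pr P x - pr Q x)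
             + norm (affine_offset P - affine_offset Q)" for P Q :: "'a set"
    by (simp add: grassmann_dist_def pr_def)
  have nonneg: "0 \<le> grassmann_dist P Q" if "P \<in> ?G" "Q \<in> ?G" for P Q
    using onorm_pos_le[OF bl[OF that]] by (simp add: d)
  have comm: "grassmann_dist P Q = grassmann_dist Q P" for P Q :: "'a set"
    using onorm_neg[of "\<lambda>x. pr P x - pr Q x"] by (simp add: d norm_minus_commute)
  have zero: "grassmann_dist P Q = 0 \<longleftrightarrow> P = Q" if PQ: "P \<in> ?G" "Q \<in> ?G" for P Q
  proof
    assume "grassmann_dist P Q = 0"
    then have o: "onorm (\<lambda>x. pr P x - pr Q x) = 0" and a: "affine_offset P = affine_offset Q"
      using onorm_pos_le[OF bl[OF PQ]] norm_ge_zero[of "affine_offset P - affine_offset Q"]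
      by (auto simp: d add_nonneg_eq_0_iff)
    have eq: "pr P x = pr Q x" for x
      using o onorm_eq_0[OF bl[OF PQ]] by simp
    have rng: "affine_direction R = range (pr R)" if "R \<in> ?G" for R
    proof -
      have s: "subspace (affine_direction R)" using dec[OF that] by simp
      have "pr R x = x" if "x \<in> affine_direction R" for x
        unfolding pr_def using s that
        by (intro orth_proj_unique) (auto simp: orthogonal_comp_def orthogonal_def)
      then show ?thesis
        using orth_proj_works(1)[OF s] unfolding pr_def by (metis (no_types)
            image_subsetI rangeI subsetI subset_antisym)
    qed
    have "affine_direction P = affine_direction Q"
      using eq rng PQ by simp
    then show "P = Q" using a dec PQ by metis
  next
    assume "P = Q"
    then show "grassmann_dist P Q = 0" by (simp add: d onorm_zero)
  qed
  have tri: "grassmann_dist P R \<le> grassmann_dist P Q + grassmann_dist Q R"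
    if "P \<in> ?G" "Q \<in> ?G" "R \<in> ?G" for P Q R
  proof -
    have "onorm (\<lambda>x. (pr P x - pr Q x) + (pr Q x - pr R x))
        \<le> onorm (\<lambda>x. pr P x - pr Q x) + onorm (\<lambda>x. pr Q x - pr R x)"
      using that by (intro onorm_triangle bl)
    then show ?thesis
      using norm_triangle_ineq[of "affine_offset P - affine_offset Q"
          "affine_offset Q - affine_offset R"]
      by (simp add: d)
  qed
  show ?thesis
    using nonneg comm zero tri by (intro Metric_space.intro) auto
qed

lemma natural_metric_exists: "\<exists>\<rho> :: 'a::euclidean_space set metric. natural_metric k \<rho>"
proof -
  let ?G = "affine_grassmannian k :: 'a set set"
  let ?d = "\<lambda>P Q. if P \<in> ?G \<and> Q \<in> ?G then grassmann_dist P Q else 0"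
  interpret Metric_space ?G ?d by (rule Metric_space_grassmann_dist)
  have "natural_metric k (metric (?G, ?d))"
    unfolding natural_metric_def by (auto intro!: exI[of _ 1])
  then show ?thesis ..
qed

end

theory Submission
  imports Defs "HOL-Real_Asymp.Real_Asymp"
begin

text \<open>
  The proof is a second moment argument at one well-chosen scale. Suppose that
  \<open>dim B < u < 2 s - k + t\<close> for some \<open>s < \<alpha>\<close> and \<open>t < min (dim E) 1\<close>. Cover \<open>B\<close> by balls with
  \<open>\<Sum> r\<^sup>u\<close> tiny and group the balls by dyadic radius. Hausdorff content is countably subadditive on
  arbitrary sets, so a double pigeonhole selects one scale \<open>\<delta> = (1/2)\<^sup>l\<close>, with \<open>l\<close> as large as desired,
  such that the planes \<open>P \<in> E\<close> for which the \<open>\<delta>\<close>-balls capture \<open>s\<close>-dimensional content at least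
  \<open>c / l\<^sup>2\<close> of \<open>P \<inter> B\<close> themselves have \<open>t\<close>-dimensional content at least \<open>c / l\<^sup>2\<close>. The set \<open>F\<close> of
  centres of these balls has at most about \<open>\<delta> powr - u\<close> elements.

  At this scale everything may be replaced by finite sets. A Frostman lemma for finite nets
  (\<open>discrete_Frostman\<close>) gives a measure \<open>\<mu>\<close> on finitely many planes with \<open>\<mu> (ball r) \<lesssim> r\<^sup>t\<close>
  and, on each such plane \<open>P\<close>, a measure \<open>\<nu>\<^sub>P\<close> on finitely many points with
  \<open>\<nu>\<^sub>P (ball r) \<lesssim> r\<^sup>s\<close>, both for \<open>r \<ge> \<delta>\<close>, and all of them with total mass polynomial in \<open>1 / l\<close>.
  Pushing the points to the centres in \<open>F\<close>, the Cauchy-Schwarz inequality bounds the square of the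
  total mass by \<open>card F\<close> times the \<open>\<mu>\<close>-average over pairs \<open>P, Q\<close> of the correlation
  \<open>\<Sum>x\<in>F. \<nu>\<^sub>P x * \<nu>\<^sub>Q x\<close>.

  The geometric input (\<open>correlation\<close>) is that this correlation is \<open>\<lesssim> \<delta> powr (2 s - k) * (\<delta> / r)\<close>
  with \<open>r = max (d P Q) \<delta>\<close>. One factor is at most \<open>\<delta>\<^sup>s\<close> pointwise. The points of one of
  the two planes that are \<open>2 \<delta>\<close>-close to the other one lie in a slab of width about
  \<open>D = \<delta> / r\<close>, which is covered by about \<open>D powr (1 - k)\<close> sets of diameter about \<open>D\<close>, and so have
  mass \<open>\<lesssim> D powr (s - k + 1) \<le> \<delta> powr (s - k) * D\<close>, since \<open>s \<le> k\<close> and \<open>D \<gtrsim> \<delta>\<close>. As \<open>t \<le> 1\<close>, averaging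
  \<open>\<delta> / r\<close> over \<open>Q\<close> gives \<open>\<lesssim> l * \<delta>\<^sup>t\<close> (\<open>Frostman_energy\<close>). Altogether a negative power of \<open>l\<close> is bounded
  by a power of \<open>l\<close> times \<open>\<delta> powr (2 s - k + t - u)\<close>, which fails once \<open>l\<close> is large.
\<close>

section \<open>Hausdorff content\<close>

text \<open>
  Covers by balls instead of arbitrary sets, with no bound on the radii: the value differs from the
  usual Hausdorff content only by constant factors, so it has the same null sets as the
  \<open>s\<close>-dimensional Hausdorff measure for \<open>s > 0\<close>. Content is preferred to the measure because it is not
  a limit over scales: a lower bound for it can be contradicted by a single cover with balls of
  moderate size. Radius \<open>0\<close> gives the empty ball, so finite covers are included.
\<close>

definition ball_content :: "'a metric \<Rightarrow> real \<Rightarrow> 'a set \<Rightarrow> ennreal" where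
  "ball_content m s A =
     (INF (x, r) \<in> {(x :: nat \<Rightarrow> 'a, r). (\<forall>i. 0 \<le> r i) \<and> A \<subseteq> (\<Union>i. mball_of m (x i) (r i))}.
        \<Sum>i. ennreal (r i powr s))"

lemma ball_content_le:
  assumes "\<And>i::nat. 0 \<le> r i" "A \<subseteq> (\<Union>i. mball_of m (x i) (r i))"
  shows "ball_content m s A \<le> (\<Sum>i. ennreal (r i powr s))"
  unfolding ball_content_def by (rule INF_lower2[of "(x, r)"]) (use assms in auto)

lemma ball_content_lessE:
  assumes "ball_content m s A < y"
  obtains x r where "\<And>i::nat. 0 \<le> r i" "A \<subseteq> (\<Union>i. mball_of m (x i) (r i))"
    "(\<Sum>i. ennreal (r i powr s)) < y"
  using assms unfolding ball_content_def INF_less_iff by auto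

lemma ball_content_mono:
  assumes "A \<subseteq> A'"
  shows "ball_content m s A \<le> ball_content m s A'"
  unfolding ball_content_def by (rule INF_superset_mono) (use assms in auto)

lemma ball_content_finite_cover:
  assumes "finite I" "\<And>i. i \<in> I \<Longrightarrow> 0 \<le> r i" "A \<subseteq> (\<Union>i\<in>I. mball_of m (x i) (r i))"
  shows "ball_content m s A \<le> ennreal (\<Sum>i\<in>I. r i powr s)"
proof -
  obtain h where h: "bij_betw h {0..<card I} I"
    using ex_bij_betw_nat_finite[OF assms(1)] by blast
  let ?r = "\<lambda>n. if n < card I then r (h n) else 0"
  have hI: "h n \<in> I" if "n < card I" for n
    using h that by (auto simp: bij_betw_def)
  have "ball_content m s A \<le> (\<Sum>n. ennreal (?r n powr s))"
  proof (rule ball_content_le)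
    show "A \<subseteq> (\<Union>n. mball_of m (x (h n)) (?r n))"
    proof
      fix a assume "a \<in> A"
      then obtain i where i: "i \<in> I" "a \<in> mball_of m (x i) (r i)" using assms(3) by blast
      have "i \<in> h ` {0..<card I}" using h i(1) by (simp add: bij_betw_def)
      then obtain n where "n < card I" "i = h n" by auto
      then show "a \<in> (\<Union>n. mball_of m (x (h n)) (?r n))" using i by (intro UN_I[of n]) auto
    qed
  qed (use assms(2) hI in auto)
  also have "\<dots> = (\<Sum>n\<in>{0..<card I}. ennreal (?r n powr s))"
    by (rule suminf_finite) auto
  also have "\<dots> = ennreal (\<Sum>n\<in>{0..<card I}. r (h n) powr s)"
    by simp
  also have "(\<Sum>n\<in>{0..<card I}. r (h n) powr s) = (\<Sum>i\<in>I. r i powr s)"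
    by (rule sum.reindex_bij_betw[OF h])
  finally show ?thesis .
qed

lemma ball_content_empty [simp]: "ball_content m s {} = 0"
  using ball_content_finite_cover[of "{}" undefined "{}" m undefined s] by simp

lemma ball_content_UN_le:
  "ball_content m s (\<Union>n. A n) \<le> (\<Sum>n::nat. ball_content m s (A n))"
proof (rule ennreal_le_epsilon)
  fix e :: real assume fin: "(\<Sum>n. ball_content m s (A n)) < top" and e: "0 < e"
  define cov where "cov n p \<longleftrightarrow> (\<forall>i::nat. 0 \<le> snd p i) \<and>
      A n \<subseteq> (\<Union>i. mball_of m (fst p i) (snd p i)) \<and>
      (\<Sum>i. ennreal (snd p i powr s)) \<le> ball_content m s (A n) + ennreal (e * (1/2) ^ Suc n)" for n p
  have "\<exists>p. cov n p" for n
  proof -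
    have "ball_content m s (A n) < top"
      using fin ennreal_suminf_lessD by blast
    moreover have "0 < e * (1/2) ^ Suc n" using e by simp
    ultimately have "ball_content m s (A n) < ball_content m s (A n) + ennreal (e * (1/2) ^ Suc n)"
      using ennreal_add_left_cancel_less[of "ball_content m s (A n)" 0 "ennreal (e * (1/2) ^ Suc n)"]
      by (simp del: power_Suc)
    then obtain x r where "\<And>i::nat. 0 \<le> r i" "A n \<subseteq> (\<Union>i. mball_of m (x i) (r i))"
      "(\<Sum>i. ennreal (r i powr s)) < ball_content m s (A n) + ennreal (e * (1/2) ^ Suc n)"
      by (rule ball_content_lessE) blast
    then show ?thesis unfolding cov_def by (intro exI[of _ "(x, r)"]) auto
  qed
  then obtain p where cov: "\<And>n. cov n (p n)" by metis
  define x where "x n = fst (p n)" for n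
  define r where "r n = snd (p n)" for n
  have r: "0 \<le> r n i" and c: "A n \<subseteq> (\<Union>i. mball_of m (x n i) (r n i))" and
    sm: "(\<Sum>i. ennreal (r n i powr s)) \<le> ball_content m s (A n) + ennreal (e * (1/2) ^ Suc n)" for n i
    using cov[of n] unfolding cov_def x_def r_def by auto
  define x' where "x' p = case_prod x (prod_decode p)" for p
  define r' where "r' p = case_prod r (prod_decode p)" for p
  have "ball_content m s (\<Union>n. A n) \<le> (\<Sum>p. ennreal (r' p powr s))"
  proof (rule ball_content_le)
    show "0 \<le> r' p" for p using r by (simp add: r'_def split: prod.split)
    show "(\<Union>n. A n) \<subseteq> (\<Union>p. mball_of m (x' p) (r' p))"
    proof
      fix a assume "a \<in> (\<Union>n. A n)"
      then obtain n i where "a \<in> mball_of m (x n i) (r n i)" using c by blast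
      then show "a \<in> (\<Union>p. mball_of m (x' p) (r' p))"
        by (intro UN_I[of "prod_encode (n, i)"]) (auto simp: x'_def r'_def)
    qed
  qed
  also have "\<dots> = (\<Sum>p. case_prod (\<lambda>n i. ennreal (r n i powr s)) (prod_decode p))"
    by (simp add: r'_def case_prod_beta)
  also have "\<dots> = (\<Sum>n. \<Sum>i. ennreal (r n i powr s))"
    by (rule suminf_ennreal_2dimen) (simp add: case_prod_beta)
  also have "\<dots> \<le> (\<Sum>n. ball_content m s (A n) + ennreal (e * (1/2) ^ Suc n))"
    by (intro suminf_le sm summableI)
  also have "\<dots> = (\<Sum>n. ball_content m s (A n)) + (\<Sum>n. ennreal (e * (1/2) ^ Suc n))"
    by (rule suminf_add[symmetric]) (rule summableI)+
  also have "(\<Sum>n. ennreal (e * (1/2) ^ Suc n)) = ennreal e"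
  proof -
    have "(\<lambda>n. e * (1/2) ^ Suc n) sums (e * 1)"
      using power_half_series by (rule sums_mult)
    then show ?thesis using e by (intro sums_unique[symmetric]) auto
  qed
  finally show "ball_content m s (\<Union>n. A n) \<le> (\<Sum>n. ball_content m s (A n)) + ennreal e" .
qed

lemma ball_content_pos_UN:
  assumes "0 < ball_content m s (\<Union>n::nat. A n)"
  obtains n where "0 < ball_content m s (A n)"
proof -
  have "\<exists>n. ball_content m s (A n) \<noteq> 0"
  proof (rule ccontr)
    assume "\<nexists>n. ball_content m s (A n) \<noteq> 0"
    then have "(\<Sum>n. ball_content m s (A n)) = 0" by simp
    then show False using assms ball_content_UN_le[of m s A] by simp
  qed
  then show ?thesis using that by (auto simp: zero_less_iff_neq_zero)
qed

text \<open>
  The weights \<open>1 / (n + 1)\<^sup>2\<close> are summable, with sum \<open>\<pi>\<^sup>2 / 6 < 2\<close>, so the pieces cannot all lie below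
  their share of \<open>c\<close>. Polynomial weights keep the loss negligible against any power of
  \<open>(1/2)\<^sup>n\<close>.
\<close>

lemma ball_content_pigeonhole:
  assumes "ennreal c < ball_content m s A" "A \<subseteq> (\<Union>n::nat. A' n)" "0 < c"
  obtains n where "ennreal (c / (2 * (real n + 1)\<^sup>2)) \<le> ball_content m s (A' n)"
proof -
  define w where "w n = c / (2 * (real n + 1)\<^sup>2)" for n
  have "(\<lambda>n. c / 2 * (1 / (real n + 1)\<^sup>2)) sums (c / 2 * (pi\<^sup>2 / 6))"
    using inverse_squares_sums by (intro sums_mult) (simp add: add.commute)
  then have w: "w sums (c * (pi\<^sup>2 / 12))" by (simp add: w_def[abs_def])
  have w0: "0 \<le> w n" for n using assms(3) by (simp add: w_def)
  have "pi\<^sup>2 \<le> 3.2\<^sup>2" using pi_less_4 pi_approx by (intro power_mono) auto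
  then have "c * (pi\<^sup>2 / 12) \<le> c * 1" using assms(3) by (intro mult_left_mono) (auto simp: power2_eq_square)
  have "\<exists>n. ennreal (w n) \<le> ball_content m s (A' n)"
  proof (rule ccontr)
    assume "\<nexists>n. ennreal (w n) \<le> ball_content m s (A' n)"
    then have "ball_content m s (A' n) \<le> ennreal (w n)" for n by (meson linear)
    then have "(\<Sum>n. ball_content m s (A' n)) \<le> (\<Sum>n. ennreal (w n))"
      by (intro suminf_le summableI)
    also have "\<dots> = ennreal (c * (pi\<^sup>2 / 12))"
      using w assms(3) by (intro sums_unique[symmetric] sums_ennreal[THEN iffD2]) (auto simp: w0)
    also have "\<dots> \<le> ennreal c" using \<open>c * (pi\<^sup>2 / 12) \<le> c * 1\<close> by (intro ennreal_leI) simp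
    finally show False
      using assms(1) ball_content_mono[OF assms(2), of m s] ball_content_UN_le[of m s A'] by (auto dest: leD)
  qed
  then show ?thesis using that by (auto simp: w_def)
qed

section \<open>Content and Hausdorff dimension\<close>

lemma ediam_mball_le: "ediam m (mball_of m x r) \<le> ennreal (2 * r)"
  unfolding ediam_def
proof (intro SUP_least ennreal_leI)
  fix y z assume a: "y \<in> mball_of m x r" "z \<in> mball_of m x r"
  interpret Metric_space "mspace m" "mdist m" by simp
  show "mdist m y z \<le> 2 * r"
    using a triangle[of y x z] commute[of x y] by (auto)
qed

lemma mdist_le_ediam:
  assumes "y \<in> U" "z \<in> U"
  shows "ennreal (mdist m y z) \<le> ediam m U"
  unfolding ediam_def using assms by (meson SUP_upper2 order_refl)

text \<open>
  If the content vanishes, covers with a tiny sum \<open>\<Sum> r\<^sup>s\<close> automatically have tiny radii, and are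
  therefore admissible in the definition of the Hausdorff measure at any given scale.
\<close>

lemma ball_content_pos:
  assumes s: "0 < s" and dim: "ereal s < hausdorff_dim m A"
  shows "0 < ball_content m s A"
proof (rule ccontr)
  assume "\<not> 0 < ball_content m s A"
  then have z: "ball_content m s A = 0" by simp
  have "hausdorff_premeasure m s \<delta> A = 0" if \<delta>: "0 < \<delta>" for \<delta>
  proof -
    have "hausdorff_premeasure m s \<delta> A \<le> 0 + ennreal e" if e: "0 < e" for e
    proof -
      let ?e = "min (e / 2 powr s) ((\<delta> / 2) powr s)"
      have e': "0 < ?e" using e \<delta> by simp
      then have "ball_content m s A < ennreal ?e" using z by (simp del: min_less_iff_conj)
      then obtain x r where r: "\<And>i::nat. 0 \<le> r i" and c: "A \<subseteq> (\<Union>i. mball_of m (x i) (r i))"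
        and sm: "(\<Sum>i. ennreal (r i powr s)) < ennreal ?e"
        by (rule ball_content_lessE) blast
      have rd: "r i \<le> \<delta> / 2" for i
      proof (rule ccontr)
        assume "\<not> r i \<le> \<delta> / 2"
        then have "(\<delta> / 2) powr s \<le> r i powr s" using \<delta> s by (intro powr_mono2) auto
        moreover have "ennreal (r i powr s) < ennreal ?e"
          using sm by (rule ennreal_suminf_lessD)
        ultimately show False by (simp add: ennreal_less_iff)
      qed
      have dle: "ediam m (mball_of m (x i) (r i)) \<le> ennreal (2 * r i)" for i
        by (rule ediam_mball_le)
      have "hausdorff_premeasure m s \<delta> A \<le> (\<Sum>i. diam_gauge m s (mball_of m (x i) (r i)))"
        unfolding hausdorff_premeasure_def
      proof (rule INF_lower, intro CollectI conjI allI c)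
        fix i
        show "ediam m (mball_of m (x i) (r i)) \<le> ennreal \<delta>"
          by (rule order_trans[OF dle]) (use rd[of i] in \<open>auto intro: ennreal_leI\<close>)
      qed auto
      also have "\<dots> \<le> (\<Sum>i. ennreal (2 powr s) * ennreal (r i powr s))"
      proof (intro suminf_le summableI)
        fix i
        have "enn2real (ediam m (mball_of m (x i) (r i))) \<le> enn2real (ennreal (2 * r i))"
          by (rule enn2real_mono[OF dle]) simp
        then have "enn2real (ediam m (mball_of m (x i) (r i))) \<le> 2 * r i"
          using r[of i] by simp
        then have "enn2real (ediam m (mball_of m (x i) (r i))) powr s \<le> (2 * r i) powr s"
          using s by (intro powr_mono2) auto
        also have "\<dots> = 2 powr s * r i powr s" using r by (simp add: powr_mult)
        finally show "diam_gauge m s (mball_of m (x i) (r i)) \<le> ennreal (2 powr s) * ennreal (r i powr s)"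
          using s by (auto simp: diam_gauge_def intro: ennreal_leI simp flip: ennreal_mult)
      qed
      also have "\<dots> = ennreal (2 powr s) * (\<Sum>i. ennreal (r i powr s))" by simp
      also have "\<dots> \<le> ennreal (2 powr s) * ennreal (e / 2 powr s)"
      proof (rule mult_left_mono)
        show "(\<Sum>i. ennreal (r i powr s)) \<le> ennreal (e / 2 powr s)"
        by (rule order_trans[OF less_imp_le[OF sm] ennreal_leI]) simp
      qed simp
      also have "\<dots> = ennreal e" using e by (simp flip: ennreal_mult)
      finally show ?thesis by simp
    qed
    then have "hausdorff_premeasure m s \<delta> A \<le> 0" by (rule ennreal_le_epsilon)
    then show ?thesis by simp
  qed
  then have "hausdorff_measure m s A = 0"
    unfolding hausdorff_measure_def by (intro antisym SUP_least) auto
  then have "hausdorff_dim m A \<le> ereal s"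
    unfolding hausdorff_dim_def by (intro INF_lower) (use s in auto)
  then show False using dim by simp
qed

text \<open>
  A set \<open>U\<close> of diameter \<open>d\<close> is replaced by an open ball of radius \<open>d + \<eta>\<close> around one of its points,
  where the \<open>u\<close>-th powers of the \<open>\<eta>\<close> have a small sum. Passing from the exponent \<open>s < u\<close> to \<open>u\<close> covers
  the case \<open>s = 0\<close>, whose gauge is not a power of the diameter.
\<close>

lemma ball_content_zero:
  assumes dim: "hausdorff_dim m A < ereal u"
  shows "ball_content m u A = 0"
proof -
  obtain s where s: "0 \<le> s" "hausdorff_measure m s A = 0" "s < u"
    using dim unfolding hausdorff_dim_def INF_less_iff by auto
  have u: "0 < u" using s by simp
  have pre: "hausdorff_premeasure m s 1 A = 0"
  proof -
    have "hausdorff_premeasure m s 1 A \<le> hausdorff_measure m s A"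
      unfolding hausdorff_measure_def by (rule SUP_upper) auto
    then show ?thesis using s by simp
  qed

  have "ball_content m u A \<le> 0 + ennreal e" if e: "0 < e" for e
  proof -
    define e' where "e' = e / (2 * 2 powr u)"
    have e': "0 < e'" using e by (simp add: e'_def)
    have "hausdorff_premeasure m s 1 A < ennreal e'" using pre e' by simp
    then obtain U where U: "A \<subseteq> (\<Union>i::nat. U i)" "\<And>i. U i \<subseteq> mspace m" "\<And>i. ediam m (U i) \<le> ennreal 1"
      and sm: "(\<Sum>i. diam_gauge m s (U i)) < ennreal e'"
      unfolding hausdorff_premeasure_def INF_less_iff by blast
    define d where "d i = enn2real (ediam m (U i))" for i
    define \<eta> where "\<eta> i = (e' * (1/2) ^ Suc i) powr (1 / u)" for i
    define x where "x i = (SOME y. y \<in> U i)" for i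
    define r where "r i = (if U i = {} then 0 else d i + \<eta> i)" for i
    have d0: "0 \<le> d i" for i by (simp add: d_def)
    have ediam: "ediam m (U i) = ennreal (d i)" for i
      unfolding d_def by (metis U(3) ennreal_enn2real ennreal_less_top le_less_trans)
    have d1: "d i \<le> 1" for i
      using U(3)[of i] unfolding ediam by (simp del: ennreal_1)
    have \<eta>0: "0 < \<eta> i" for i using e' by (simp add: \<eta>_def)
    have \<eta>u: "\<eta> i powr u = e' * (1/2) ^ Suc i" for i
      using e' u by (simp add: \<eta>_def powr_powr)
    have xU: "x i \<in> U i" if "U i \<noteq> {}" for i
      using that some_in_eq by (auto simp: x_def)
    have "ball_content m u A \<le> (\<Sum>i. ennreal (r i powr u))"
    proof (rule ball_content_le)
      show "0 \<le> r i" for i using d0[of i] \<eta>0[of i] by (simp add: r_def)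
      show "A \<subseteq> (\<Union>i. mball_of m (x i) (r i))"
      proof
        fix a assume "a \<in> A"
        then obtain i where a: "a \<in> U i" using U by blast
        then have "U i \<noteq> {}" by auto
        have "ennreal (mdist m (x i) a) \<le> ediam m (U i)"
          using xU a by (intro mdist_le_ediam) auto
        then have "mdist m (x i) a \<le> d i" unfolding ediam using d0 by simp
        then have "a \<in> mball_of m (x i) (r i)"
          using a xU[OF \<open>U i \<noteq> {}\<close>] U(2)[of i] \<eta>0[of i] by (auto simp: r_def)
        then show "a \<in> (\<Union>i. mball_of m (x i) (r i))" by blast
      qed
    qed
    also have "\<dots> \<le> (\<Sum>i. ennreal (2 powr u) * (diam_gauge m s (U i) + ennreal (e' * (1/2) ^ Suc i)))"
    proof (intro suminf_le summableI)
      fix i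
      show "ennreal (r i powr u) \<le> ennreal (2 powr u) * (diam_gauge m s (U i) + ennreal (e' * (1/2) ^ Suc i))"
      proof (cases "U i = {}")
        case False
        \<comment> \<open>the cover has mesh at most \<open>1\<close>, so lowering the exponent increases the power\<close>
        have g: "ennreal (d i powr u) \<le> diam_gauge m s (U i)"
        proof (cases "s = 0")
          case True
          then show ?thesis using False d1[of i] d0[of i] u
            by (simp add: diam_gauge_def powr_le1 flip: ennreal_1 del: ennreal_1)
        next
          case s0: False
          show ?thesis
          proof (cases "d i = 0")
            case f: False
            then have "d i powr u \<le> d i powr s"
              using d0[of i] d1[of i] s by (intro powr_mono') auto
            then show ?thesis using False s0 by (simp add: diam_gauge_def ennreal_leI flip: d_def)
          qed auto
        qed
        have "(d i + \<eta> i) powr u \<le> (2 * max (d i) (\<eta> i)) powr u"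
          using d0[of i] \<eta>0[of i] u by (intro powr_mono2) auto
        also have "\<dots> = 2 powr u * max (d i) (\<eta> i) powr u"
          using \<eta>0[of i] by (simp add: powr_mult)
        also have "\<dots> \<le> 2 powr u * (d i powr u + \<eta> i powr u)"
          by (intro mult_left_mono) (auto simp: max_def)
        finally have "ennreal (r i powr u) \<le> ennreal (2 powr u * (d i powr u + e' * (1/2) ^ Suc i))"
          using False by (intro ennreal_leI) (simp add: r_def \<eta>u)
        also have "\<dots> = ennreal (2 powr u) * (ennreal (d i powr u) + ennreal (e' * (1/2) ^ Suc i))"
          using e' by (simp add: ennreal_mult)
        also have "\<dots> \<le> ennreal (2 powr u) * (diam_gauge m s (U i) + ennreal (e' * (1/2) ^ Suc i))"
          by (intro mult_left_mono add_right_mono g) auto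
        finally show ?thesis .
      qed (simp add: r_def)
    qed
    also have "\<dots> = ennreal (2 powr u) * ((\<Sum>i. diam_gauge m s (U i)) + (\<Sum>i. ennreal (e' * (1/2) ^ Suc i)))"
      by (subst suminf_add) auto
    also have "(\<Sum>i. ennreal (e' * (1/2) ^ Suc i)) = ennreal e'"
    proof -
      have "(\<lambda>n. e' * (1/2) ^ Suc n) sums (e' * 1)"
        using power_half_series by (rule sums_mult)
      then show ?thesis using e' by (intro sums_unique[symmetric]) auto
    qed
    also have "ennreal (2 powr u) * ((\<Sum>i. diam_gauge m s (U i)) + ennreal e') \<le>
        ennreal (2 powr u) * (ennreal e' + ennreal e')"
      using sm by (intro mult_left_mono add_right_mono) auto
    also have "\<dots> = ennreal (2 powr u * (e' + e'))"
      using e' by (simp flip: ennreal_mult ennreal_plus)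
    also have "2 powr u * (e' + e') = e" by (simp add: e'_def)
    finally show ?thesis by simp
  qed
  then have "ball_content m u A \<le> 0" by (rule ennreal_le_epsilon)
  then show ?thesis by simp
qed

lemma hausdorff_dim_mono:
  assumes "A \<subseteq> A'"
  shows "hausdorff_dim m A \<le> hausdorff_dim m A'"
proof -
  have "hausdorff_premeasure m s \<delta> A \<le> hausdorff_premeasure m s \<delta> A'" for s \<delta>
    unfolding hausdorff_premeasure_def by (rule INF_superset_mono) (use assms in auto)
  then have "hausdorff_measure m s A \<le> hausdorff_measure m s A'" for s
    unfolding hausdorff_measure_def by (rule SUP_mono')
  then have "hausdorff_measure m s A' = 0 \<Longrightarrow> hausdorff_measure m s A = 0" for s
    by (metis le_zero_eq)
  then show ?thesis
    unfolding hausdorff_dim_def by (intro INF_superset_mono) auto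
qed

section \<open>Frostman measures on finite sets\<close>

lemma dyadic_scale:
  fixes r :: real
  assumes "0 < r" "r < 1"
  obtains j where "r < (1/2)^j" "(1/2)^j \<le> 2 * r"
proof -
  define j where "j = (LEAST j. (1/2::real)^j \<le> r)"
  have ex: "\<exists>j. (1/2::real)^j \<le> r"
    using real_arch_pow_inv[of r "1/2"] assms by (auto intro: less_imp_le)
  have j: "(1/2::real)^j \<le> r" unfolding j_def using ex by (rule LeastI_ex)
  then have "j \<noteq> 0" using assms by (intro notI) simp
  then obtain i where i: "j = Suc i" by (cases j) auto
  have "\<not> (1/2::real)^i \<le> r"
    unfolding j_def by (rule not_less_Least) (use i in \<open>simp add: j_def\<close>)
  then show ?thesis using that[of i] j i by simp
qed

text \<open>
  The points are treated one after the other, each receiving the largest mass that violates no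
  constraint. This saturates one of the cells containing the point, and a saturated cell stays
  saturated, because masses are never decreased.
\<close>

lemma greedy_packing:
  fixes c :: "'i \<Rightarrow> 'a set" and w :: "'i \<Rightarrow> real"
  assumes "finite X" "finite I" "\<And>i. i \<in> I \<Longrightarrow> 0 \<le> w i" "X \<subseteq> (\<Union>i\<in>I. c i)"
  shows "\<exists>\<mu>. (\<forall>x. 0 \<le> \<mu> x) \<and> (\<forall>i\<in>I. sum \<mu> (X \<inter> c i) \<le> w i) \<and>
    (\<forall>x\<in>X. \<exists>i\<in>I. x \<in> c i \<and> sum \<mu> (X \<inter> c i) = w i)"
  using assms(1,4)
proof (induction X)
  case empty
  show ?case by (rule exI[of _ "\<lambda>_. 0"]) (use assms(3) in auto)
next
  case (insert x F)
  then have "F \<subseteq> (\<Union>i\<in>I. c i)" by simp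
  from insert.IH[OF this] obtain \<mu> where "(\<forall>x. 0 \<le> \<mu> x) \<and> (\<forall>i\<in>I. sum \<mu> (F \<inter> c i) \<le> w i) \<and>
    (\<forall>x\<in>F. \<exists>i\<in>I. x \<in> c i \<and> sum \<mu> (F \<inter> c i) = w i)" ..
  then have \<mu>: "\<And>y. 0 \<le> \<mu> y" "\<And>i. i \<in> I \<Longrightarrow> sum \<mu> (F \<inter> c i) \<le> w i"
    "\<And>y. y \<in> F \<Longrightarrow> \<exists>i\<in>I. y \<in> c i \<and> sum \<mu> (F \<inter> c i) = w i" by simp_all
  define J where "J = {i\<in>I. x \<in> c i}"
  define e where "e = Min ((\<lambda>i. w i - sum \<mu> (F \<inter> c i)) ` J)"
  have J: "finite J" "J \<noteq> {}" using assms(2) insert.prems by (auto simp: J_def)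
  have e_le: "e \<le> w i - sum \<mu> (F \<inter> c i)" if "i \<in> J" for i
    unfolding e_def using J that by (intro Min_le) auto
  have "e \<in> (\<lambda>i. w i - sum \<mu> (F \<inter> c i)) ` J"
    unfolding e_def using J by (intro Min_in) auto
  then obtain i0 where i0: "i0 \<in> J" "e = w i0 - sum \<mu> (F \<inter> c i0)" by auto
  have e0: "0 \<le> e" using i0 \<mu>(2)[of i0] by (auto simp: J_def)
  define \<mu>' where "\<mu>' = \<mu>(x := e)"
  have sum': "sum \<mu>' (insert x F \<inter> c i) = sum \<mu> (F \<inter> c i) + (if x \<in> c i then e else 0)" for i
  proof -
    have "sum \<mu>' (F \<inter> c i) = sum \<mu> (F \<inter> c i)"
      using insert.hyps by (intro sum.cong) (auto simp: \<mu>'_def)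
    then show ?thesis using insert.hyps by (auto simp: Int_insert_left \<mu>'_def)
  qed
  have le: "sum \<mu>' (insert x F \<inter> c i) \<le> w i" if "i \<in> I" for i
    using \<mu>(2)[OF that] e_le[of i] that by (auto simp: sum' J_def)
  show ?case
  proof (intro exI[of _ \<mu>'] conjI allI ballI)
    show "0 \<le> \<mu>' y" for y using \<mu>(1) e0 by (simp add: \<mu>'_def)
    show "sum \<mu>' (insert x F \<inter> c i) \<le> w i" if "i \<in> I" for i by (rule le[OF that])
    fix y assume "y \<in> insert x F"
    then consider "y = x" | "y \<in> F" by auto
    then show "\<exists>i\<in>I. y \<in> c i \<and> sum \<mu>' (insert x F \<inter> c i) = w i"
    proof cases
      case 1
      have "sum \<mu>' (insert x F \<inter> c i0) = w i0"
        unfolding sum' using i0 by (simp add: J_def)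
      with 1 show ?thesis using i0 by (intro bexI[of _ i0]) (auto simp: J_def)
    next
      case 2
      then obtain i where i: "i \<in> I" "y \<in> c i" "sum \<mu> (F \<inter> c i) = w i" using \<mu>(3) by blast
      then have "sum \<mu>' (insert x F \<inter> c i) = w i"
        using le[OF i(1)] e0 by (auto simp: sum')
      then show ?thesis using i by blast
    qed
  qed
qed

text \<open>
  The selection picks a member of largest radius, discards everything that meets it, and repeats.
\<close>

lemma finite_Vitali:
  fixes c :: "'i \<Rightarrow> 'a set" and r :: "'i \<Rightarrow> real"
  assumes "finite I" "\<And>i. i \<in> I \<Longrightarrow> c i \<noteq> {}"
  shows "\<exists>J\<subseteq>I. disjoint_family_on c J \<and> (\<forall>i\<in>I. \<exists>j\<in>J. r i \<le> r j \<and> c i \<inter> c j \<noteq> {})"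
  using assms
proof (induction I rule: finite_psubset_induct)
  case (psubset I)
  show ?case
  proof (cases "I = {}")
    case False
    have "Max (r ` I) \<in> r ` I" using psubset.hyps False by (intro Max_in) auto
    then obtain k where k: "k \<in> I" "r k = Max (r ` I)" by auto
    then have k_max: "r i \<le> r k" if "i \<in> I" for i using psubset.hyps that by simp
    define I' where "I' = {i\<in>I. c i \<inter> c k = {}}"
    have "k \<notin> I'" using psubset.prems k by (auto simp: I'_def)
    then have "I' \<subset> I" using k by (auto simp: I'_def)
    then obtain J where J: "J \<subseteq> I'" "disjoint_family_on c J"
      "\<And>i. i \<in> I' \<Longrightarrow> \<exists>j\<in>J. r i \<le> r j \<and> c i \<inter> c j \<noteq> {}"
      using psubset.IH[of I'] psubset.prems by (auto simp: I'_def)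
    show ?thesis
    proof (intro exI[of _ "insert k J"] conjI ballI)
      show "insert k J \<subseteq> I" using J k by (auto simp: I'_def)
      show "disjoint_family_on c (insert k J)"
        using J by (fastforce simp: disjoint_family_on_def I'_def)
      fix i assume i: "i \<in> I"
      show "\<exists>j\<in>insert k J. r i \<le> r j \<and> c i \<inter> c j \<noteq> {}"
      proof (cases "i \<in> I'")
        case True
        then show ?thesis using J(3) by blast
      next
        case False
        then show ?thesis using i k_max[OF i] by (auto simp: I'_def)
      qed
    qed
  qed (auto simp: disjoint_family_on_def)
qed

text \<open>
  A discrete analogue of a Frostman measure: the \<open>s\<close>-dimensional growth bound is only required at
  radii above the resolution \<open>\<delta>\<close>. The factor \<open>2\<close> allows the bound for dyadic radii to be
  passed to all radii.
\<close>

definition frostman :: "('a \<Rightarrow> 'a \<Rightarrow> real) \<Rightarrow> real \<Rightarrow> real \<Rightarrow> 'a set \<Rightarrow> ('a \<Rightarrow> real) \<Rightarrow> bool" where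
  "frostman d s \<delta> X \<mu> \<longleftrightarrow> finite X \<and> (\<forall>x. 0 \<le> \<mu> x) \<and> sum \<mu> X \<le> 1 \<and>
     (\<forall>x\<in>X. \<forall>r\<ge>\<delta>. sum \<mu> {y\<in>X. d x y \<le> r} \<le> (2 * r) powr s)"

text \<open>
  Give each dyadic ball \<open>ball x r\<close> with \<open>r \<ge> (1/2)\<^sup>l\<close> the capacity \<open>r\<^sup>s\<close> and distribute mass greedily.
  Every point of \<open>X\<close> then lies in a saturated ball. Among the saturated balls choose a disjoint Vitali
  subfamily. Its fourfold enlargements cover \<open>E\<close>, so the content of \<open>E\<close> is at most
  \<open>\<Sum> (4 r)\<^sup>s\<close>, that is \<open>4\<^sup>s\<close> times the mass of the subfamily. Scaling down normalises the total mass.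
\<close>

lemma discrete_Frostman:
  fixes m :: "'a metric"
  assumes s: "0 < s" and X: "finite X" "X \<subseteq> mspace m" and cov: "E \<subseteq> (\<Union>x\<in>X. mball_of m x ((1/2)^l))"
    and \<kappa>: "0 \<le> \<kappa>" "\<kappa> \<le> 1" "ennreal \<kappa> \<le> ball_content m s E"
  obtains \<mu> where "frostman (mdist m) s ((1/2)^l) X \<mu>" "sum \<mu> X = \<kappa> / 4 powr s"
proof -
  interpret Metric_space "mspace m" "mdist m" by simp
  define I where "I = X \<times> {..l}"
  define r where "r i = (1/2::real) ^ snd i" for i :: "'a \<times> nat"
  define c where "c i = mball_of m (fst i) (r i)" for i :: "'a \<times> nat"
  have finI: "finite I" using X by (simp add: I_def)
  have r0: "0 < r i" for i by (simp add: r_def)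
  have "X \<subseteq> (\<Union>i\<in>I. c i)"
  proof
    fix x assume "x \<in> X"
    then show "x \<in> (\<Union>i\<in>I. c i)"
      using X by (intro UN_I[of "(x, 0)"]) (auto simp: I_def c_def r_def)
  qed
  then have "\<exists>\<mu>. (\<forall>x. 0 \<le> \<mu> x) \<and> (\<forall>i\<in>I. sum \<mu> (X \<inter> c i) \<le> r i powr s) \<and>
    (\<forall>x\<in>X. \<exists>i\<in>I. x \<in> c i \<and> sum \<mu> (X \<inter> c i) = r i powr s)"
    by (intro greedy_packing X finI) auto
  then obtain \<mu>\<^sub>0 where "(\<forall>x. 0 \<le> \<mu>\<^sub>0 x) \<and> (\<forall>i\<in>I. sum \<mu>\<^sub>0 (X \<inter> c i) \<le> r i powr s) \<and>
    (\<forall>x\<in>X. \<exists>i\<in>I. x \<in> c i \<and> sum \<mu>\<^sub>0 (X \<inter> c i) = r i powr s)" ..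
  then have \<mu>\<^sub>0: "\<And>x. 0 \<le> \<mu>\<^sub>0 x" "\<And>i. i \<in> I \<Longrightarrow> sum \<mu>\<^sub>0 (X \<inter> c i) \<le> r i powr s"
    "\<And>x. x \<in> X \<Longrightarrow> \<exists>i\<in>I. x \<in> c i \<and> sum \<mu>\<^sub>0 (X \<inter> c i) = r i powr s"
    by simp_all
  define S where "S = {i\<in>I. sum \<mu>\<^sub>0 (X \<inter> c i) = r i powr s}"
  have finS: "finite S" using finI by (simp add: S_def)
  have "c i \<noteq> {}" if "i \<in> S" for i
    using that X r0[of i] by (auto simp: S_def I_def c_def intro!: exI[of _ "fst i"])
  from finite_Vitali[where c = c and r = r, OF finS this] obtain J where J: "J \<subseteq> S" "disjoint_family_on c J"
    "\<And>i. i \<in> S \<Longrightarrow> \<exists>j\<in>J. r i \<le> r j \<and> c i \<inter> c j \<noteq> {}" by auto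
  have finJ: "finite J" using J(1) finS by (rule finite_subset)
  have JX: "fst j \<in> X \<and> (1/2)^l \<le> r j" if "j \<in> J" for j
    using that J(1) by (auto simp: S_def I_def r_def intro!: power_decreasing)
  \<comment> \<open>a factor \<open>3\<close> comes from the Vitali selection; \<open>4\<close> also absorbs the distance to the net\<close>
  have "E \<subseteq> (\<Union>j\<in>J. mball_of m (fst j) (4 * r j))"
  proof
    fix e assume "e \<in> E"
    then obtain x where x: "x \<in> X" "e \<in> mball_of m x ((1/2)^l)" using cov by blast
    obtain i where i: "i \<in> S" "x \<in> c i" using \<mu>\<^sub>0(3)[OF x(1)] by (auto simp: S_def)
    obtain j where j: "j \<in> J" "r i \<le> r j" "c i \<inter> c j \<noteq> {}" using J(3)[OF i(1)] by blast
    then obtain u where u: "u \<in> c i" "u \<in> c j" by blast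
    have "mdist m (fst j) e \<le> mdist m (fst j) u + mdist m u e"
      using u x by (intro triangle) (auto simp: c_def)
    also have "mdist m u e \<le> mdist m u (fst i) + mdist m (fst i) e"
      using u x i by (intro triangle) (auto simp: c_def)
    also have "mdist m (fst i) e \<le> mdist m (fst i) x + mdist m x e"
      using u x i by (intro triangle) (auto simp: c_def)
    finally have "mdist m (fst j) e < 4 * r j"
      using u x(2) i(2) j(2) JX[OF j(1)] commute[of u "fst i"] by (auto simp: c_def)
    then show "e \<in> (\<Union>j\<in>J. mball_of m (fst j) (4 * r j))"
      using j(1) u x by (intro UN_I[of j]) (auto simp: c_def)
  qed
  then have "ennreal \<kappa> \<le> ennreal (\<Sum>j\<in>J. (4 * r j) powr s)"
    using r0 by (intro order_trans[OF \<kappa>(3)] ball_content_finite_cover finJ) (auto simp: less_imp_le)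
  then have "\<kappa> \<le> (\<Sum>j\<in>J. (4 * r j) powr s)"
    by (subst (asm) ennreal_le_iff) (auto intro: sum_nonneg)
  also have "\<dots> = (\<Sum>j\<in>J. 4 powr s * sum \<mu>\<^sub>0 (X \<inter> c j))"
  proof (rule sum.cong[OF refl])
    fix j assume "j \<in> J"
    then have "sum \<mu>\<^sub>0 (X \<inter> c j) = r j powr s" using J(1) by (auto simp: S_def)
    then show "(4 * r j) powr s = 4 powr s * sum \<mu>\<^sub>0 (X \<inter> c j)"
      using r0[of j] by (simp add: powr_mult)
  qed
  also have "\<dots> = 4 powr s * (\<Sum>j\<in>J. sum \<mu>\<^sub>0 (X \<inter> c j))" by (rule sum_distrib_left[symmetric])
  also have "(\<Sum>j\<in>J. sum \<mu>\<^sub>0 (X \<inter> c j)) = sum \<mu>\<^sub>0 (\<Union>j\<in>J. X \<inter> c j)"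
  proof (rule sum.UNION_disjoint[symmetric])
    show "\<forall>i\<in>J. \<forall>j\<in>J. i \<noteq> j \<longrightarrow> (X \<inter> c i) \<inter> (X \<inter> c j) = {}"
      using J(2) unfolding disjoint_family_on_def by blast
  qed (use X finJ in auto)
  also have "\<dots> \<le> sum \<mu>\<^sub>0 X"
    using X \<mu>\<^sub>0(1) by (intro sum_mono2) auto
  finally have T: "\<kappa> / 4 powr s \<le> sum \<mu>\<^sub>0 X" by (simp add: field_simps)
  define p where "p = \<kappa> / 4 powr s"
  define f where "f = p / sum \<mu>\<^sub>0 X"
  have "0 \<le> p" "p \<le> sum \<mu>\<^sub>0 X" using \<kappa>(1) T by (simp_all add: p_def)
  then have "0 \<le> f" "f \<le> 1" "f * sum \<mu>\<^sub>0 X = p"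
    by (auto simp: f_def divide_le_eq_1)
  then have f: "0 \<le> f" "f \<le> 1" "f * sum \<mu>\<^sub>0 X = \<kappa> / 4 powr s" by (simp_all add: p_def)
  have tot: "(\<Sum>x\<in>X. f * \<mu>\<^sub>0 x) = \<kappa> / 4 powr s" using f by (simp flip: sum_distrib_left)
  moreover have tot1: "\<kappa> / 4 powr s \<le> 1"
    using \<kappa> s ge_one_powr_ge_zero[of 4 s] by (simp add: divide_le_eq)
  ultimately show ?thesis
  proof (intro that[of "\<lambda>x. f * \<mu>\<^sub>0 x"], unfold frostman_def, intro conjI allI ballI impI)
    show "0 \<le> f * \<mu>\<^sub>0 x" for x using f \<mu>\<^sub>0(1) by simp
    fix x R assume x: "x \<in> X" and R: "(1/2)^l \<le> (R::real)"
    have R0: "0 < R" using R by (rule less_le_trans[rotated]) simp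
    show "(\<Sum>y\<in>{y\<in>X. mdist m x y \<le> R}. f * \<mu>\<^sub>0 y) \<le> (2 * R) powr s"
    proof (cases "R < 1")
      case True
      obtain j where j: "R < (1/2)^j" "(1/2)^j \<le> 2 * R" by (rule dyadic_scale[OF R0 True])
      have "(1/2::real)^l < (1/2)^j" using R j by linarith
      then have jl: "j \<le> l" by (simp add: power_strict_decreasing_iff)
      have "(\<Sum>y\<in>{y\<in>X. mdist m x y \<le> R}. f * \<mu>\<^sub>0 y) \<le> (\<Sum>y\<in>{y\<in>X. mdist m x y \<le> R}. 1 * \<mu>\<^sub>0 y)"
        by (intro sum_mono mult_right_mono f \<mu>\<^sub>0(1))
      also have "\<dots> \<le> (\<Sum>y\<in>X \<inter> c (x, j). \<mu>\<^sub>0 y)"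
        using X j(1) x by (simp, intro sum_mono2 \<mu>\<^sub>0(1)) (auto simp: c_def r_def)
      also have "\<dots> \<le> r (x, j) powr s" by (rule \<mu>\<^sub>0(2)) (use x jl in \<open>auto simp: I_def\<close>)
      also have "\<dots> \<le> (2 * R) powr s"
        using j s by (intro powr_mono2) (auto simp: r_def)
      finally show ?thesis .
    next
      case False
      have "(\<Sum>y\<in>{y\<in>X. mdist m x y \<le> R}. f * \<mu>\<^sub>0 y) \<le> (\<Sum>x\<in>X. f * \<mu>\<^sub>0 x)"
        using X f \<mu>\<^sub>0(1) by (intro sum_mono2) auto
      also have "\<dots> \<le> 1" unfolding tot by (rule tot1)
      also have "\<dots> \<le> (2 * R) powr s" using False s by (intro ge_one_powr_ge_zero) auto
      finally show ?thesis .
    qed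
  qed (use X in simp_all)
qed

text \<open>
  Bound \<open>\<delta> / max d \<delta>\<close> by a sum over dyadic balls. The level \<open>q = (1/2)\<^sup>j\<close> contributes about
  \<open>(\<delta> / q) * q\<^sup>t \<le> \<delta>\<^sup>t\<close>, where \<open>t \<le> 1\<close> and \<open>\<delta> \<le> q\<close> are used, and there are \<open>l + 1\<close> levels. Distances
  above \<open>1\<close> contribute at most \<open>\<delta>\<close>.
\<close>

lemma Frostman_energy:
  fixes d' :: "'a \<Rightarrow> 'a \<Rightarrow> real" and l :: nat
  defines "\<delta> \<equiv> (1/2::real)^l"
  assumes t: "0 < t" "t \<le> 1" and fr: "frostman d' t \<delta> X \<mu>" and x: "x \<in> X"
  shows "(\<Sum>y\<in>X. \<mu> y * (\<delta> / max (d' x y) \<delta>)) \<le> (4 * real l + 5) * \<delta> powr t"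
proof -
  define d where "d = d' x"
  have X: "finite X" and \<mu>: "\<And>y. 0 \<le> \<mu> y" "sum \<mu> X \<le> 1"
    and ball: "\<And>r. \<delta> \<le> r \<Longrightarrow> sum \<mu> {y\<in>X. d y \<le> r} \<le> (2 * r) powr t"
    using fr x by (auto simp: frostman_def d_def)
  have \<delta>: "0 < \<delta>" "\<delta> \<le> 1" by (auto simp: \<delta>_def power_le_one)
  let ?I = "\<lambda>y j. if d y \<le> (1/2)^j then 2 * (\<delta> / (1/2)^j) else 0 :: real"
  have I0: "0 \<le> ?I y j" for y j using \<delta> by simp
  have pt: "\<delta> / max (d y) \<delta> \<le> \<delta> + (\<Sum>j\<le>l. ?I y j)" for y
  proof -
    have sum0: "0 \<le> (\<Sum>j\<le>l. ?I y j)" by (intro sum_nonneg I0)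
    consider "1 \<le> d y" | "d y \<le> \<delta>" | "\<delta> < d y" "d y < 1" by linarith
    then show ?thesis
    proof cases
      case 1
      then have "\<delta> / max (d y) \<delta> \<le> \<delta> / 1" using \<delta> by (intro divide_left_mono) auto
      then show ?thesis using sum0 by simp
    next
      case 2
      have "?I y l \<le> (\<Sum>j\<le>l. ?I y j)" by (intro member_le_sum I0) auto
      moreover have "?I y l = 2" using 2 \<delta> by (simp add: \<delta>_def)
      moreover have "\<delta> / max (d y) \<delta> = 1" using 2 \<delta> by (simp add: max_absorb2)
      ultimately show ?thesis using \<delta> by simp
    next
      case 3
      then have "0 < d y" using \<delta> by linarith
      then obtain j where j: "d y < (1/2)^j" "(1/2)^j \<le> 2 * d y"
        using dyadic_scale 3(2) by blast
      have "(1/2::real)^l < (1/2)^j" using 3(1) j unfolding \<delta>_def by linarith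
      then have jl: "j \<le> l" by (simp add: power_strict_decreasing_iff)
      have "\<delta> / max (d y) \<delta> = 2 * (\<delta> / (2 * d y))" using 3 by (simp add: max_def)
      also have "\<dots> \<le> 2 * (\<delta> / (1/2)^j)"
        using j \<delta> by (intro mult_left_mono divide_left_mono) (auto intro!: mult_pos_pos \<open>0 < d y\<close>)
      also have "\<dots> = ?I y j" using j by simp
      also have "\<dots> \<le> (\<Sum>j\<le>l. ?I y j)" using jl by (intro member_le_sum I0) auto
      finally show ?thesis using \<delta> by simp
    qed
  qed
  have lev: "2 * (\<delta> / (1/2)^j) * sum \<mu> {y\<in>X. d y \<le> (1/2)^j} \<le> 4 * \<delta> powr t" if "j \<le> l" for j
  proof -
    define q where "q = (1/2::real)^j"
    have q: "0 < q" "\<delta> \<le> q" using that by (auto simp: q_def \<delta>_def intro: power_decreasing)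
    have "sum \<mu> {y\<in>X. d y \<le> q} \<le> (2 * q) powr t" by (rule ball[OF q(2)])
    also have "\<dots> = 2 powr t * q powr t" using q by (simp add: powr_mult)
    also have "\<dots> \<le> 2 * q powr t"
      using powr_mono[of t 1 2] t by (intro mult_right_mono) auto
    finally have "2 * (\<delta> / q) * sum \<mu> {y\<in>X. d y \<le> q} \<le> 2 * (\<delta> / q) * (2 * q powr t)"
      using \<delta> q by (intro mult_left_mono) auto
    also have "\<dots> = 4 * ((\<delta> / q) * q powr t)" by simp
    also have "\<dots> \<le> 4 * ((\<delta> / q) powr t * q powr t)"
    proof (intro mult_left_mono mult_right_mono)
      show "\<delta> / q \<le> (\<delta> / q) powr t"
        using powr_mono'[of t 1 "\<delta> / q"] t \<delta> q by simp
    qed (use \<delta> in auto)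
    also have "(\<delta> / q) powr t * q powr t = \<delta> powr t"
      using \<delta> q by (simp add: powr_divide)
    finally show ?thesis by (simp add: q_def)
  qed
  have "(\<Sum>y\<in>X. \<mu> y * (\<delta> / max (d y) \<delta>)) \<le> (\<Sum>y\<in>X. \<mu> y * (\<delta> + (\<Sum>j\<le>l. ?I y j)))"
    by (intro sum_mono mult_left_mono pt \<mu>)
  also have "\<dots> = \<delta> * sum \<mu> X + (\<Sum>y\<in>X. \<Sum>j\<le>l. \<mu> y * ?I y j)"
    by (simp add: distrib_left sum.distrib sum_distrib_left mult.commute)
  also have "(\<Sum>y\<in>X. \<Sum>j\<le>l. \<mu> y * ?I y j) = (\<Sum>j\<le>l. \<Sum>y\<in>X. \<mu> y * ?I y j)"
    by (rule sum.swap)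
  also have "\<dots> = (\<Sum>j\<le>l. 2 * (\<delta> / (1/2)^j) * sum \<mu> {y\<in>X. d y \<le> (1/2)^j})"
  proof (rule sum.cong[OF refl])
    fix j
    have "(\<Sum>y\<in>X. \<mu> y * ?I y j) = (\<Sum>y\<in>{y\<in>X. d y \<le> (1/2)^j}. \<mu> y * (2 * (\<delta> / (1/2)^j)))"
      using X by (intro sum.mono_neutral_cong_right) auto
    then show "(\<Sum>y\<in>X. \<mu> y * ?I y j) = 2 * (\<delta> / (1/2)^j) * sum \<mu> {y\<in>X. d y \<le> (1/2)^j}"
      by (simp add: sum_distrib_left mult.commute)
  qed
  also have "\<delta> * sum \<mu> X + \<dots> \<le> \<delta> powr t + (\<Sum>j\<le>l. 4 * \<delta> powr t)"
  proof (intro add_mono sum_mono lev)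
    have "\<delta> * sum \<mu> X \<le> \<delta> * 1" using \<delta> \<mu> by (intro mult_left_mono) auto
    also have "\<dots> \<le> \<delta> powr t" using powr_mono'[of t 1 \<delta>] t \<delta> by simp
    finally show "\<delta> * sum \<mu> X \<le> \<delta> powr t" .
  qed auto
  also have "\<dots> = (4 * real l + 5) * \<delta> powr t" by (simp add: algebra_simps)
  finally show ?thesis by (simp add: d_def)
qed

text \<open>
  The Cauchy-Schwarz inequality for the \<open>\<mu>\<close>-average of the functions \<open>g P\<close>, which live on \<open>F\<close>.
\<close>

lemma sum_squared_le_card_sum_correlations:
  fixes g :: "'p \<Rightarrow> 'x \<Rightarrow> real"
  shows "(\<Sum>P\<in>X. \<mu> P * (\<Sum>x\<in>F. g P x))\<^sup>2
    \<le> real (card F) * (\<Sum>P\<in>X. \<Sum>Q\<in>X. \<mu> P * \<mu> Q * (\<Sum>x\<in>F. g P x * g Q x))"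
proof -
  define h where "h x = (\<Sum>P\<in>X. \<mu> P * g P x)" for x
  have "(\<Sum>P\<in>X. \<mu> P * (\<Sum>x\<in>F. g P x)) = (\<Sum>x\<in>F. 1 * h x)"
    unfolding h_def sum_distrib_left by (subst sum.swap) simp
  then have "(\<Sum>P\<in>X. \<mu> P * (\<Sum>x\<in>F. g P x))\<^sup>2 \<le> (\<Sum>x\<in>F. 1\<^sup>2) * (\<Sum>x\<in>F. (h x)\<^sup>2)"
    using Cauchy_Schwarz_ineq_sum[of "\<lambda>_. 1" h F] by simp
  also have "(\<Sum>x\<in>F. (h x)\<^sup>2) = (\<Sum>x\<in>F. \<Sum>P\<in>X. \<Sum>Q\<in>X. \<mu> P * \<mu> Q * (g P x * g Q x))"
    by (simp add: h_def power2_eq_square sum_product mult_ac)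
  also have "\<dots> = (\<Sum>P\<in>X. \<Sum>x\<in>F. \<Sum>Q\<in>X. \<mu> P * \<mu> Q * (g P x * g Q x))"
    by (rule sum.swap)
  also have "\<dots> = (\<Sum>P\<in>X. \<Sum>Q\<in>X. \<Sum>x\<in>F. \<mu> P * \<mu> Q * (g P x * g Q x))"
    by (intro sum.cong refl sum.swap)
  finally show ?thesis by (simp add: sum_distrib_left)
qed

section \<open>Neighbourhoods of one plane within another\<close>

lemma inner_orth_proj:
  fixes V :: "'a::euclidean_space set"
  assumes "subspace V" "v \<in> V"
  shows "v \<bullet> orth_proj V x = v \<bullet> x"
proof -
  have "x - orth_proj V x \<in> orthogonal_comp V" by (rule orth_proj_works(2)[OF assms(1)])
  then have "v \<bullet> (x - orth_proj V x) = 0"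
    using assms(2) by (auto simp: orthogonal_comp_def orthogonal_def)
  then show ?thesis by (simp add: inner_diff_right)
qed

lemma orth_proj_decomp_norm:
  fixes V :: "'a::euclidean_space set"
  assumes "subspace V"
  shows "norm (orth_proj V x) \<le> norm x" "norm (x - orth_proj V x) \<le> norm x"
proof -
  have "orth_proj V x \<bullet> (x - orth_proj V x) = 0"
    using inner_orth_proj[OF assms orth_proj_works(1)[OF assms], of x x] by (simp add: inner_diff_right)
  then have "(norm (orth_proj V x))\<^sup>2 + (norm (x - orth_proj V x))\<^sup>2 = (norm x)\<^sup>2"
    by (simp add: power2_norm_eq_inner inner_diff_left inner_diff_right inner_commute)
  moreover have "0 \<le> (norm (orth_proj V x))\<^sup>2" "0 \<le> (norm (x - orth_proj V x))\<^sup>2" by simp_all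
  ultimately have "(norm (orth_proj V x))\<^sup>2 \<le> (norm x)\<^sup>2" "(norm (x - orth_proj V x))\<^sup>2 \<le> (norm x)\<^sup>2"
    by linarith+
  then show "norm (orth_proj V x) \<le> norm x" "norm (x - orth_proj V x) \<le> norm x"
    by (simp_all add: power2_le_iff_abs_le)
qed

text \<open>
  If two subspaces are far apart, then a vector of one of them is far from the other one. It is left
  open which subspace contains that vector: the correlation of two measures is symmetric, so the roles
  of the two planes may be exchanged. With \<open>y = \<pi>\<^sub>V x - \<pi>\<^sub>W x\<close>, the square of \<open>norm y\<close> is split into a part
  that measures how far \<open>\<pi>\<^sub>V x\<close> is from \<open>W\<close> and, since projections are self-adjoint, a part that measures how
  far \<open>\<pi>\<^sub>W y\<close> is from \<open>V\<close>.
\<close>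

lemma onorm_orth_proj_diff_le:
  fixes V W :: "'a::euclidean_space set"
  assumes V: "subspace V" and W: "subspace W" and c: "0 \<le> c"
    and VW: "\<And>v. v \<in> V \<Longrightarrow> norm (v - orth_proj W v) \<le> c * norm v"
    and WV: "\<And>w. w \<in> W \<Longrightarrow> norm (w - orth_proj V w) \<le> c * norm w"
  shows "onorm (\<lambda>x. orth_proj V x - orth_proj W x) \<le> 2 * c"
proof (rule onorm_le)
  fix x
  let ?p = "orth_proj V" and ?q = "orth_proj W"
  define y where "y = ?p x - ?q x"
  have q: "linear ?q" by (rule linear_orth_proj[OF W])
  have "y \<bullet> y = (?p x - ?q (?p x)) \<bullet> y - (?q (x - ?p x)) \<bullet> y"
    by (simp add: linear_diff[OF q] y_def flip: inner_diff_left)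
  also have "?q (x - ?p x) \<bullet> y = (x - ?p x) \<bullet> ?q y"
    using inner_orth_proj[OF W orth_proj_works(1)[OF W], of "x - ?p x" y]
      inner_orth_proj[OF W orth_proj_works(1)[OF W], of y "x - ?p x"]
    by (simp add: inner_commute)
  also have "\<dots> = (x - ?p x) \<bullet> (?q y - ?p (?q y))"
    using inner_orth_proj[OF V orth_proj_works(1)[OF V], of "?q y" x]
    by (simp add: inner_diff_left inner_diff_right inner_commute)
  finally have "(norm y)\<^sup>2 = (?p x - ?q (?p x)) \<bullet> y - (x - ?p x) \<bullet> (?q y - ?p (?q y))"
    by (simp add: power2_norm_eq_inner)
  also have "\<dots> \<le> norm (?p x - ?q (?p x)) * norm y + norm (x - ?p x) * norm (?q y - ?p (?q y))"
    using norm_cauchy_schwarz[of "?p x - ?q (?p x)" y] Cauchy_Schwarz_ineq2[of "x - ?p x" "?q y - ?p (?q y)"]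
    by linarith
  also have "\<dots> \<le> (c * norm x) * norm y + norm x * (c * norm y)"
  proof (intro add_mono mult_mono)
    show "norm (?p x - ?q (?p x)) \<le> c * norm x"
      using VW[OF orth_proj_works(1)[OF V], of x] mult_left_mono[OF orth_proj_decomp_norm(1)[OF V, of x] c]
      by linarith
    show "norm (?q y - ?p (?q y)) \<le> c * norm y"
      using WV[OF orth_proj_works(1)[OF W], of y] mult_left_mono[OF orth_proj_decomp_norm(1)[OF W, of y] c]
      by linarith
    show "norm (x - ?p x) \<le> norm x" by (rule orth_proj_decomp_norm(2)[OF V])
  qed (use c in auto)
  finally have "norm y * norm y \<le> (2 * c * norm x) * norm y"
    by (simp add: power2_eq_square algebra_simps)
  then show "norm (orth_proj V x - orth_proj W x) \<le> 2 * c * norm x"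
    using c by (cases "norm y = 0") (auto simp: y_def mult_le_cancel_right)
qed

text \<open>
  The component \<open>w\<close> of \<open>v\<close> orthogonal to \<open>W\<close> defines a linear functional that is constant on \<open>Q\<close>, hence
  varies by at most \<open>2 \<epsilon>\<close> on the \<open>\<epsilon>\<close>-neighbourhood of \<open>Q\<close>. On \<open>P\<close> its gradient is the projection of the
  unit vector along \<open>w\<close> to \<open>V\<close>, which is longer than \<open>c\<close> because of \<open>v\<close>. The normalised gradient is \<open>h\<close>.
\<close>

lemma slab_one_side:
  fixes V W :: "'a::euclidean_space set"
  assumes V: "subspace V" and W: "subspace W" and P: "P = (+) a ` V" and Q: "Q = (+) b ` W"
    and v: "v \<in> V" "c * norm v < norm (v - orth_proj W v)" and c: "0 < c"
  shows "\<exists>h\<in>V. norm h = 1 \<and> (\<forall>x\<in>P. \<forall>y\<in>P. \<forall>z\<in>Q. \<forall>z'\<in>Q.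
    dist x z < \<epsilon> \<longrightarrow> dist y z' < \<epsilon> \<longrightarrow> \<bar>(x - y) \<bullet> h\<bar> \<le> 2 * \<epsilon> / c)"
proof -
  define w where "w = v - orth_proj W v"
  have "0 \<le> c * norm v" using c by simp
  then have w0: "0 < norm w" using v(2) unfolding w_def by linarith
  define e where "e = w /\<^sub>R norm w"
  have e1: "norm e = 1" using w0 by (simp add: e_def)
  have wW: "u \<bullet> w = 0" if "u \<in> W" for u
    using inner_orth_proj[OF W that, of v] by (simp add: w_def inner_diff_right)
  then have eW: "u \<bullet> e = 0" if "u \<in> W" for u using that by (simp add: e_def)
  define g where "g = orth_proj V e"
  have gV: "g \<in> V" unfolding g_def by (rule orth_proj_works(1)[OF V])
  have Vg: "u \<bullet> g = u \<bullet> e" if "u \<in> V" for u unfolding g_def by (rule inner_orth_proj[OF V that])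
  have "v \<bullet> w = w \<bullet> w"
    using wW[OF orth_proj_works(1)[OF W], of v] by (simp add: w_def inner_diff_left)
  then have "v \<bullet> g = norm w"
    using w0 by (simp add: Vg[OF v(1)] e_def dot_square_norm power2_eq_square)
  then have "norm w \<le> norm v * norm g" using norm_cauchy_schwarz[of v g] by simp
  with v(2) have "c * norm v < norm g * norm v" by (simp add: w_def mult.commute)
  then have cg: "c < norm g" by (rule mult_right_less_imp_less) simp
  show ?thesis
  proof (intro bexI[of _ "g /\<^sub>R norm g"] conjI ballI impI)
    have "norm g \<noteq> 0" using cg c by auto
    then show "norm (g /\<^sub>R norm g) = 1" by simp
    show "g /\<^sub>R norm g \<in> V" using V gV by (simp add: subspace_scale)
    fix x y z z' assume x: "x \<in> P" "y \<in> P" and z: "z \<in> Q" "z' \<in> Q"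
      and d: "dist x z < \<epsilon>" "dist y z' < \<epsilon>"
    have "x - y \<in> V" using x P V by (auto simp: subspace_diff)
    then have "(x - y) \<bullet> g = (x - y) \<bullet> e" by (rule Vg)
    also have "\<dots> = (x - z) \<bullet> e + (z - z') \<bullet> e - (y - z') \<bullet> e"
      by (simp add: inner_diff_left)
    also have "(z - z') \<bullet> e = 0" using z Q W by (intro eW) (auto simp: subspace_diff)
    finally have "\<bar>(x - y) \<bullet> g\<bar> \<le> \<bar>(x - z) \<bullet> e\<bar> + \<bar>(y - z') \<bullet> e\<bar>" by linarith
    also have "\<dots> \<le> norm (x - z) * norm e + norm (y - z') * norm e"
      by (intro add_mono Cauchy_Schwarz_ineq2)
    also have "\<dots> \<le> 2 * \<epsilon>" using d e1 by (simp add: dist_norm)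
    finally have g2: "\<bar>(x - y) \<bullet> g\<bar> \<le> 2 * \<epsilon>" .
    have e0: "0 \<le> \<epsilon>" using d zero_le_dist[of x z] by linarith
    have "\<bar>(x - y) \<bullet> (g /\<^sub>R norm g)\<bar> = \<bar>(x - y) \<bullet> g\<bar> / norm g"
      by (simp add: abs_mult divide_inverse mult.commute)
    also have "\<dots> \<le> 2 * \<epsilon> / c"
      using g2 cg c e0 by (intro frac_le) auto
    finally show "\<bar>(x - y) \<bullet> (g /\<^sub>R norm g)\<bar> \<le> 2 * \<epsilon> / c" .
  qed
qed

text \<open>
  The part of \<open>P\<close> that is \<open>\<epsilon>\<close>-close to \<open>Q\<close> lies between two parallel hyperplanes of \<open>P\<close> at distance \<open>D\<close>.
  Bounding differences of pairs of points avoids naming the position of the hyperplanes.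
\<close>

definition in_thin_slab :: "'a::euclidean_space set \<Rightarrow> 'a set \<Rightarrow> real \<Rightarrow> real \<Rightarrow> bool" where
  "in_thin_slab P Q \<epsilon> D \<longleftrightarrow> (\<exists>h\<in>affine_direction P. norm h = 1 \<and>
     (\<forall>x\<in>P. \<forall>y\<in>P. \<forall>z\<in>Q. \<forall>z'\<in>Q. dist x z < \<epsilon> \<longrightarrow> dist y z' < \<epsilon> \<longrightarrow> \<bar>(x - y) \<bullet> h\<bar> \<le> D))"

lemma affine_grassmannian_direction_offset:
  fixes P :: "'a::euclidean_space set"
  assumes "P \<in> affine_grassmannian k"
  shows "subspace (affine_direction P)" "dim (affine_direction P) = k"
    "affine_offset P \<in> orthogonal_comp (affine_direction P)"
    "P = (+) (affine_offset P) ` affine_direction P"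
  using assms unfolding affine_grassmannian_decomp
  by (auto simp: affine_direction_eq affine_offset_eq)

lemma affine_offset_of_mem:
  fixes P :: "'a::euclidean_space set"
  assumes P: "P \<in> affine_grassmannian k" and x: "x \<in> P"
  shows "affine_offset P = x - orth_proj (affine_direction P) x"
proof -
  note P' = affine_grassmannian_direction_offset[OF P]
  have "x - affine_offset P \<in> affine_direction P" using P' x by (metis (no_types, lifting) add_diff_cancel_left' imageE)
  then have "orth_proj (affine_direction P) x = x - affine_offset P"
    using P' by (intro orth_proj_unique) auto
  then show ?thesis by simp
qed

lemma bounded_linear_orth_proj_diff:
  fixes V W :: "'a::euclidean_space set"
  assumes "subspace V" "subspace W"
  shows "bounded_linear (\<lambda>x. orth_proj V x - orth_proj W x)"
  using assms linear_orth_proj by (intro bounded_linear_sub) (auto simp: linear_linear)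

lemma grassmann_dist_le:
  fixes P Q :: "'a::euclidean_space set"
  assumes P: "P \<in> affine_grassmannian k" and Q: "Q \<in> affine_grassmannian k"
    and x: "x \<in> P" "norm x \<le> R" and z: "z \<in> Q" "norm z \<le> R"
  shows "grassmann_dist P Q \<le> 2 * (R + 1)"
proof -
  note P' = affine_grassmannian_direction_offset[OF P] and Q' = affine_grassmannian_direction_offset[OF Q]
  let ?V = "affine_direction P" and ?W = "affine_direction Q"
  have "onorm (\<lambda>x. orth_proj ?V x - orth_proj ?W x) \<le> 2"
  proof (rule onorm_le)
    fix x
    show "norm (orth_proj ?V x - orth_proj ?W x) \<le> 2 * norm x"
      using norm_triangle_ineq4[of "orth_proj ?V x" "orth_proj ?W x"]
        orth_proj_decomp_norm(1)[OF P'(1), of x] orth_proj_decomp_norm(1)[OF Q'(1), of x]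
      by linarith
  qed
  moreover have "norm (affine_offset P) \<le> R"
    using orth_proj_decomp_norm(2)[OF P'(1), of x] x affine_offset_of_mem[OF P x(1)] by simp
  moreover have "norm (affine_offset Q) \<le> R"
    using orth_proj_decomp_norm(2)[OF Q'(1), of z] z affine_offset_of_mem[OF Q z(1)] by simp
  ultimately show ?thesis
    using norm_triangle_ineq4[of "affine_offset P" "affine_offset Q"] by (simp add: grassmann_dist_def)
qed

text \<open>
  The existence of one pair of close points in a bounded region controls the distance of the offsets by
  that of the directions, so \<open>d(P, Q)\<close> is comparable with \<open>\<parallel>\<pi>\<^sub>V - \<pi>\<^sub>W\<parallel>\<close>. Hence one of the two direction
  spaces contains a vector at relative distance more than \<open>c = d(P, Q) / (8 (R + 1))\<close> from the other.
\<close>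

lemma thin_slab:
  fixes P Q :: "'a::euclidean_space set"
  assumes P: "P \<in> affine_grassmannian k" and Q: "Q \<in> affine_grassmannian k"
    and x0: "x0 \<in> P" "norm x0 \<le> R" and z0: "z0 \<in> Q" "dist x0 z0 < 2 * \<delta>"
    and \<delta>: "0 < \<delta>" "4 * \<delta> \<le> grassmann_dist P Q" and R: "0 \<le> R"
  defines "D \<equiv> 32 * (R + 1) * \<delta> / grassmann_dist P Q"
  shows "in_thin_slab P Q (2 * \<delta>) D \<or> in_thin_slab Q P (2 * \<delta>) D"
proof -
  note P' = affine_grassmannian_direction_offset[OF P] and Q' = affine_grassmannian_direction_offset[OF Q]
  let ?V = "affine_direction P" and ?W = "affine_direction Q"
  define r where "r = grassmann_dist P Q"
  define A where "A x = orth_proj ?V x - orth_proj ?W x" for x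
  define c where "c = r / (8 * (R + 1))"
  have r: "0 < r" "4 * \<delta> \<le> r" using \<delta> by (auto simp: r_def)
  have c: "0 < c" using r R by (simp add: c_def)
  have D: "2 * (2 * \<delta>) / c = D" using r R by (simp add: c_def D_def r_def field_simps)
  have bl: "bounded_linear A"
    unfolding A_def by (rule bounded_linear_orth_proj_diff[OF P'(1) Q'(1)])
  have "affine_offset P - affine_offset Q = ((x0 - z0) - orth_proj ?W (x0 - z0)) - A x0"
    using affine_offset_of_mem[OF P x0(1)] affine_offset_of_mem[OF Q z0(1)]
    by (simp add: A_def linear_diff[OF linear_orth_proj[OF Q'(1)]])
  then have "norm (affine_offset P - affine_offset Q)
      \<le> norm ((x0 - z0) - orth_proj ?W (x0 - z0)) + norm (A x0)"
    using norm_triangle_ineq4 by metis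
  also have "norm ((x0 - z0) - orth_proj ?W (x0 - z0)) \<le> 2 * \<delta>"
    using orth_proj_decomp_norm(2)[OF Q'(1), of "x0 - z0"] z0 by (simp add: dist_norm)
  also have "norm (A x0) \<le> onorm A * R"
    using onorm[OF bl, of x0] mult_left_mono[OF x0(2) onorm_pos_le[OF bl]] by linarith
  finally have "r \<le> 2 * \<delta> + (R + 1) * onorm A"
    by (simp add: r_def grassmann_dist_def A_def[abs_def] algebra_simps)
  then have "r \<le> 2 * ((R + 1) * onorm A)" using r by linarith
  moreover have "r = 8 * (c * (R + 1))" using R by (simp add: c_def field_simps)
  ultimately have "4 * (c * (R + 1)) \<le> onorm A * (R + 1)" by (simp add: mult.commute)
  then have "4 * c \<le> onorm A" using R by (simp add: mult_le_cancel_right flip: mult.assoc)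
  then have "2 * c < onorm A" using c by linarith
  then have "\<not> onorm A \<le> 2 * c" by simp
  then consider v where "v \<in> ?V" "c * norm v < norm (v - orth_proj ?W v)"
    | w where "w \<in> ?W" "c * norm w < norm (w - orth_proj ?V w)"
    using onorm_orth_proj_diff_le[OF P'(1) Q'(1), of c] c unfolding A_def[abs_def]
    by (meson less_imp_le not_le)
  then show ?thesis
  proof cases
    case 1
    then show ?thesis
      using slab_one_side[OF P'(1) Q'(1) P'(4) Q'(4) 1 c, of "2 * \<delta>"]
      unfolding D in_thin_slab_def by blast
  next
    case 2
    then show ?thesis
      using slab_one_side[OF Q'(1) P'(1) Q'(4) P'(4) 2 c, of "2 * \<delta>"]
      unfolding D in_thin_slab_def by blast
  qed
qed

text \<open>
  In an orthonormal basis of \<open>V\<close> that starts with \<open>h\<close>, the set \<open>S\<close> has width \<open>D\<close> in the first direction and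
  \<open>2 R\<close> in the others. The colour of a point is its cell in a grid of mesh \<open>D\<close> in the other directions.
\<close>

lemma slab_colouring:
  fixes V :: "'a::euclidean_space set"
  assumes V: "subspace V" and h: "h \<in> V" "norm h = 1" and D: "0 < D"
    and SV: "\<And>x y. x \<in> S \<Longrightarrow> y \<in> S \<Longrightarrow> x - y \<in> V"
    and SR: "\<And>x. x \<in> S \<Longrightarrow> norm x \<le> R"
    and Sh: "\<And>x y. x \<in> S \<Longrightarrow> y \<in> S \<Longrightarrow> \<bar>(x - y) \<bullet> h\<bar> \<le> D"
    and R: "0 \<le> R"
  obtains q :: "'a \<Rightarrow> 'a \<Rightarrow> int" where "finite (q ` S)"
    "real (card (q ` S)) \<le> (2 * R / D + 2) ^ (dim V - 1)"
    "\<And>x y. x \<in> S \<Longrightarrow> y \<in> S \<Longrightarrow> q x = q y \<Longrightarrow> dist x y \<le> real (dim V) * D"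
proof -
  define W where "W = {y\<in>V. \<forall>x\<in>span {h}. orthogonal x y}"
  have "h \<noteq> 0" using h by auto
  then have "dim (span {h}) = 1" by (simp add: dim_span)
  moreover have "dim W + dim (span {h}) = dim V"
    unfolding W_def using V h by (intro dim_subspace_orthogonal_to_vectors) (auto simp: span_minimal)
  ultimately have dimW: "dim V = Suc (dim W)" by simp
  have W: "subspace W"
    using V unfolding W_def subspace_def by (auto simp: orthogonal_clauses)
  obtain B where B: "B \<subseteq> W" "pairwise orthogonal B" "\<And>x. x \<in> B \<Longrightarrow> norm x = 1"
    "independent B" "card B = dim W" "span B = W"
    using orthonormal_basis_subspace[OF W] by metis
  have finB: "finite B" using B(4) by (rule independent_imp_finite)
  define q where "q x = restrict (\<lambda>b. \<lfloor>x \<bullet> b / D\<rfloor>) B" for x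
  define I where "I = {\<lfloor>- R / D\<rfloor>..\<lfloor>R / D\<rfloor>}"
  have "q ` S \<subseteq> (B \<rightarrow>\<^sub>E I)"
  proof
    fix c assume "c \<in> q ` S"
    then obtain x where x: "x \<in> S" "c = q x" by auto
    have "\<bar>x \<bullet> b\<bar> \<le> R" if "b \<in> B" for b
      using Cauchy_Schwarz_ineq2[of x b] SR[OF x(1)] B(3)[OF that] by simp
    then have "- R \<le> x \<bullet> b \<and> x \<bullet> b \<le> R" if "b \<in> B" for b
      using that by (meson abs_le_iff minus_le_iff)
    then have "- R / D \<le> x \<bullet> b / D \<and> x \<bullet> b / D \<le> R / D" if "b \<in> B" for b
      using that D by (intro conjI divide_right_mono) auto
    then show "c \<in> (B \<rightarrow>\<^sub>E I)"
      using x unfolding q_def I_def by (auto intro!: floor_mono)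
  qed
  moreover have finP: "finite (B \<rightarrow>\<^sub>E I)" using finB by (intro finite_PiE) (auto simp: I_def)
  ultimately have fin: "finite (q ` S)" and "card (q ` S) \<le> card (B \<rightarrow>\<^sub>E I)"
    by (auto intro: finite_subset card_mono)
  then have "real (card (q ` S)) \<le> real (card I) ^ dim W"
    by (simp add: card_PiE[OF finB] B(5) flip: of_nat_power)
  also have "real (card I) \<le> 2 * R / D + 2"
  proof -
    have "\<lfloor>- R / D\<rfloor> \<le> \<lfloor>R / D\<rfloor>" using R D by (intro floor_mono divide_right_mono) auto
    then have "real (card I) = of_int (\<lfloor>R / D\<rfloor> - \<lfloor>- R / D\<rfloor> + 1)" by (simp add: I_def)
    moreover have "2 * R / D = R / D - (- R / D)" by simp
    ultimately show ?thesis
      using floor_correct[of "R / D"] floor_correct[of "- R / D"] by linarith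
  qed
  then have "real (card I) ^ dim W \<le> (2 * R / D + 2) ^ dim W" by (intro power_mono) auto
  finally have crd: "real (card (q ` S)) \<le> (2 * R / D + 2) ^ (dim V - 1)" by (simp add: dimW)
  have "dist x y \<le> real (dim V) * D" if xy: "x \<in> S" "y \<in> S" "q x = q y" for x y
  proof -
    define d where "d = x - y"
    define d' where "d' = d - (d \<bullet> h) *\<^sub>R h"
    have dV: "d \<in> V" unfolding d_def by (rule SV[OF xy(1,2)])
    have hh: "h \<bullet> h = 1" using h(2) by (simp add: dot_square_norm)
    have "d' \<in> V" unfolding d'_def using V dV h by (simp add: subspace_diff subspace_scale)
    moreover have "orthogonal x d'" if "x \<in> span {h}" for x
      using that by (auto simp: span_singleton orthogonal_def d'_def inner_diff_right hh inner_commute)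
    ultimately have "d' \<in> W" by (simp add: W_def)
    then have "d' = (\<Sum>b\<in>B. (d' \<bullet> b) *\<^sub>R b)"
      using orthonormal_basis_expand[OF B(2,3) _ finB] B(6) by simp
    then have "norm d' \<le> (\<Sum>b\<in>B. norm ((d' \<bullet> b) *\<^sub>R b))" by (metis norm_sum)
    also have "\<dots> \<le> (\<Sum>b\<in>B. D)"
    proof (rule sum_mono)
      fix b assume b: "b \<in> B"
      have "h \<bullet> b = 0" using b B(1) by (auto simp: W_def orthogonal_def span_base)
      then have db: "d' \<bullet> b = x \<bullet> b - y \<bullet> b" by (simp add: d'_def d_def inner_diff_left)
      have "\<lfloor>x \<bullet> b / D\<rfloor> = \<lfloor>y \<bullet> b / D\<rfloor>" using xy(3) b by (auto simp: q_def dest: fun_cong[of _ _ b])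
      then have "\<bar>x \<bullet> b / D - y \<bullet> b / D\<bar> \<le> 1"
        using floor_correct[of "x \<bullet> b / D"] floor_correct[of "y \<bullet> b / D"] by linarith
      then have "\<bar>x \<bullet> b - y \<bullet> b\<bar> / D \<le> 1" using D by (simp add: abs_divide flip: diff_divide_distrib)
      then have "\<bar>x \<bullet> b - y \<bullet> b\<bar> \<le> D" using D by (simp add: divide_le_eq)
      then show "norm ((d' \<bullet> b) *\<^sub>R b) \<le> D" using B(3)[OF b] by (simp add: db)
    qed
    also have "\<dots> = real (dim W) * D" by (simp add: B(5))
    finally have "norm d' \<le> real (dim W) * D" .
    moreover have "norm ((d \<bullet> h) *\<^sub>R h) \<le> D" using Sh[OF xy(1,2)] h(2) by (simp add: d_def)
    moreover have "d = d' + (d \<bullet> h) *\<^sub>R h" by (simp add: d'_def)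
    then have "norm d \<le> norm d' + norm ((d \<bullet> h) *\<^sub>R h)" by (metis norm_triangle_ineq)
    ultimately have "norm d \<le> real (Suc (dim W)) * D" by (simp add: algebra_simps)
    then show ?thesis by (simp add: dist_norm d_def dimW)
  qed
  with fin crd show ?thesis by (rule that)
qed

section \<open>Correlation of Frostman measures on two planes\<close>

lemma frostman_slab_mass:
  fixes V :: "'a::euclidean_space set"
  assumes fr: "frostman dist s \<delta> Y \<nu>" and S: "S \<subseteq> Y"
    and V: "subspace V" "1 \<le> dim V" and h: "h \<in> V" "norm h = 1" and D: "0 < D" "\<delta> \<le> D"
    and SV: "\<And>x y. x \<in> S \<Longrightarrow> y \<in> S \<Longrightarrow> x - y \<in> V"
    and SR: "\<And>x. x \<in> S \<Longrightarrow> norm x \<le> R" and R: "0 \<le> R"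
    and Sh: "\<And>x y. x \<in> S \<Longrightarrow> y \<in> S \<Longrightarrow> \<bar>(x - y) \<bullet> h\<bar> \<le> D"
  shows "sum \<nu> S \<le> (2 * R / D + 2) ^ (dim V - 1) * (2 * real (dim V) * D) powr s"
proof -
  obtain q :: "'a \<Rightarrow> 'a \<Rightarrow> int" where q: "finite (q ` S)"
    "real (card (q ` S)) \<le> (2 * R / D + 2) ^ (dim V - 1)"
    "\<And>x y. x \<in> S \<Longrightarrow> y \<in> S \<Longrightarrow> q x = q y \<Longrightarrow> dist x y \<le> real (dim V) * D"
    using slab_colouring[OF V(1) h D(1) SV SR Sh R] by blast
  let ?M = "(2 * real (dim V) * D) powr s"
  have finY: "finite Y" and \<nu>: "\<And>x. 0 \<le> \<nu> x"
    and ball: "\<And>x r. x \<in> Y \<Longrightarrow> \<delta> \<le> r \<Longrightarrow> sum \<nu> {y\<in>Y. dist x y \<le> r} \<le> (2 * r) powr s"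
    using fr by (auto simp: frostman_def)
  have finS: "finite S" using S finY by (rule finite_subset)
  have "D \<le> real (dim V) * D" using V(2) D by simp
  then have D': "\<delta> \<le> real (dim V) * D" using D by linarith
  have "sum \<nu> S = (\<Sum>c\<in>q ` S. sum \<nu> {x\<in>S. q x = c})"
    by (rule sum.image_gen[OF finS])
  also have "\<dots> \<le> (\<Sum>c\<in>q ` S. ?M)"
  proof (rule sum_mono)
    fix c assume "c \<in> q ` S"
    then obtain x where x: "x \<in> S" "c = q x" by auto
    have "sum \<nu> {y\<in>S. q y = c} \<le> sum \<nu> {y\<in>Y. dist x y \<le> real (dim V) * D}"
      using q(3)[OF x(1)] x S finY by (intro sum_mono2 \<nu>) auto
    also have "\<dots> \<le> ?M"
      using ball[of x "real (dim V) * D"] x S D' by (auto simp: mult.assoc)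
    finally show "sum \<nu> {y\<in>S. q y = c} \<le> ?M" .
  qed
  also have "\<dots> = real (card (q ` S)) * ?M" by simp
  also have "\<dots> \<le> (2 * R / D + 2) ^ (dim V - 1) * ?M"
    by (intro mult_right_mono q) auto
  finally show ?thesis .
qed

text \<open>
  The summand \<open>4\<close> serves planes at distance less than \<open>4 \<delta>\<close>, the product serves distant planes:
  up to powers of the slab width, the number of grid cells, the mass of a cell, and the ratio of the
  width to \<open>\<delta> / r\<close>.
\<close>

definition near_const :: "nat \<Rightarrow> real \<Rightarrow> real \<Rightarrow> real" where
  "near_const k s R = 4 + (18 * (R + 1)) ^ (k - 1) * (2 * real k) powr s * (32 * (R + 1))"

text \<open>
  With \<open>D\<close> the width of the slab, there are about \<open>D powr (1 - k)\<close> cells of mass about \<open>D powr s\<close>. As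
  \<open>s \<le> k\<close> and \<open>D \<ge> \<delta>\<close>, the product is at most \<open>\<delta> powr (s - k) * D\<close>.
\<close>

lemma near_mass_slab:
  fixes P Q :: "'a::euclidean_space set"
  assumes P: "P \<in> affine_grassmannian k" and k: "1 \<le> k"
    and s: "0 < s" "s \<le> real k" and R: "0 \<le> R"
    and fr: "frostman dist s \<delta> Y \<nu>" and Y: "Y \<subseteq> P \<inter> cball 0 R" and Z: "Z \<subseteq> Q"
    and \<delta>: "0 < \<delta>" "4 * \<delta> \<le> r" "r \<le> 2 * (R + 1)"
    and slab: "in_thin_slab P Q (2 * \<delta>) (32 * (R + 1) * \<delta> / r)"
  shows "sum \<nu> {y\<in>Y. \<exists>z\<in>Z. dist y z < 2 * \<delta>} \<le> near_const k s R * \<delta> powr (s - real k) * (\<delta> / r)"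
proof -
  note P' = affine_grassmannian_direction_offset[OF P]
  define D where "D = 32 * (R + 1) * \<delta> / r"
  have r: "0 < r" using \<delta> by linarith
  have "r \<le> 32 * (R + 1)" using \<delta> R by linarith
  then have D: "0 < D" "\<delta> \<le> D" using r R \<delta> by (simp_all add: D_def le_divide_eq mult.commute mult_left_mono)
  have D8: "D \<le> 8 * (R + 1)"
  proof -
    have "8 * (R + 1) * (4 * \<delta>) \<le> 8 * (R + 1) * r"
      using \<delta>(2) R by (intro mult_left_mono) auto
    then have "32 * (R + 1) * \<delta> \<le> 8 * (R + 1) * r" by (simp add: algebra_simps)
    then show ?thesis using r by (simp add: D_def divide_le_eq)
  qed
  from slab[folded D_def] obtain h where h: "h \<in> affine_direction P" "norm h = 1" and
    slab': "\<forall>x\<in>P. \<forall>y\<in>P. \<forall>z\<in>Q. \<forall>z'\<in>Q. dist x z < 2 * \<delta> \<longrightarrow> dist y z' < 2 * \<delta> \<longrightarrow> \<bar>(x - y) \<bullet> h\<bar> \<le> D"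
    unfolding in_thin_slab_def by (elim bexE conjE)
  let ?S = "{y\<in>Y. \<exists>z\<in>Z. dist y z < 2 * \<delta>}"
  have SP: "x - y \<in> affine_direction P" if xy: "x \<in> P" "y \<in> P" for x y
  proof -
    obtain u v where "u \<in> affine_direction P" "v \<in> affine_direction P"
      "x = affine_offset P + u" "y = affine_offset P + v"
      using xy P'(4) by (metis imageE)
    then show ?thesis using subspace_diff[OF P'(1), of u v] by simp
  qed
  have "sum \<nu> ?S \<le> (2 * R / D + 2) ^ (dim (affine_direction P) - 1) * (2 * real (dim (affine_direction P)) * D) powr s"
  proof (rule frostman_slab_mass[OF fr _ P'(1) _ h(1,2) D])
    show "1 \<le> dim (affine_direction P)" using k P'(2) by simp
    fix x y assume xy: "x \<in> ?S" "y \<in> ?S"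
    show "x - y \<in> affine_direction P" using xy Y by (intro SP) auto
    obtain z z' where "z \<in> Z" "dist x z < 2 * \<delta>" "z' \<in> Z" "dist y z' < 2 * \<delta>" using xy by auto
    moreover have "x \<in> P" "y \<in> P" using xy Y by auto
    ultimately show "\<bar>(x - y) \<bullet> h\<bar> \<le> D" using slab' Z by (meson subsetD)
  next
    show "?S \<subseteq> Y" by auto
    show "norm x \<le> R" if "x \<in> ?S" for x using that Y by auto
    show "0 \<le> R" by (rule R)
  qed
  also have "\<dots> = (2 * R / D + 2) ^ (k - 1) * ((2 * real k) powr s * D powr s)"
    using D by (simp add: P'(2) powr_mult)
  also have "\<dots> \<le> (18 * (R + 1) / D) ^ (k - 1) * ((2 * real k) powr s * D powr s)"
  proof (intro mult_right_mono power_mono)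
    have "2 * R + 2 * D \<le> 18 * (R + 1)" using D8 R by simp
    then have "(2 * R + 2 * D) / D \<le> 18 * (R + 1) / D" using D by (intro divide_right_mono) auto
    then show "2 * R / D + 2 \<le> 18 * (R + 1) / D" using D by (simp add: add_divide_distrib)
  qed (use D R in auto)
  also have "(18 * (R + 1) / D) ^ (k - 1) = (18 * (R + 1)) ^ (k - 1) * D powr (1 - real k)"
  proof -
    have "1 - real k = - real (k - 1)" using k by simp
    then have "D powr (1 - real k) = inverse (D ^ (k - 1))"
      by (simp only: powr_minus powr_realpow[OF D(1)])
    then show ?thesis by (simp only: divide_inverse power_mult_distrib power_inverse)
  qed
  also have "\<dots> * ((2 * real k) powr s * D powr s)
      = (18 * (R + 1)) ^ (k - 1) * (2 * real k) powr s * (D powr (s - real k) * D)"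
  proof -
    have "D powr (1 - real k) * D powr s = D powr ((s - real k) + 1)"
      by (simp add: algebra_simps flip: powr_add)
    then have "D powr (1 - real k) * D powr s = D powr (s - real k) * D"
      using D by (simp add: powr_add)
    then show ?thesis by (simp add: mult_ac)
  qed
  also have "\<dots> \<le> (18 * (R + 1)) ^ (k - 1) * (2 * real k) powr s * (\<delta> powr (s - real k) * D)"
    using D \<delta> s R by (intro mult_left_mono mult_right_mono powr_mono2') auto
  also have "\<dots> = ((18 * (R + 1)) ^ (k - 1) * (2 * real k) powr s * (32 * (R + 1))) * (\<delta> powr (s - real k) * (\<delta> / r))"
    by (simp add: D_def)
  also have "\<dots> \<le> near_const k s R * (\<delta> powr (s - real k) * (\<delta> / r))"
    using \<delta> r by (intro mult_right_mono) (auto simp: near_const_def)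
  finally show ?thesis by (simp add: mult.assoc)
qed

text \<open>
  The minimum reflects that the slab is found in one of the two planes only. For planes at distance less
  than \<open>4 \<delta>\<close> the total mass \<open>1\<close> is already a sufficient bound.
\<close>

lemma near_mass:
  fixes P Q :: "'a::euclidean_space set"
  assumes P: "P \<in> affine_grassmannian k" and Q: "Q \<in> affine_grassmannian k" and k: "1 \<le> k"
    and s: "0 < s" "s \<le> real k" and R: "0 \<le> R" and \<delta>: "0 < \<delta>" "\<delta> \<le> 1"
    and Y: "frostman dist s \<delta> Y \<nu>" "Y \<subseteq> P \<inter> cball 0 R"
    and Z: "frostman dist s \<delta> Z \<xi>" "Z \<subseteq> Q \<inter> cball 0 R"
  shows "min (sum \<nu> {y\<in>Y. \<exists>z\<in>Z. dist y z < 2 * \<delta>}) (sum \<xi> {z\<in>Z. \<exists>y\<in>Y. dist z y < 2 * \<delta>})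
    \<le> near_const k s R * \<delta> powr (s - real k) * (\<delta> / max (grassmann_dist P Q) \<delta>)"
proof -
  let ?r = "grassmann_dist P Q" and ?S = "{y\<in>Y. \<exists>z\<in>Z. dist y z < 2 * \<delta>}"
  have C: "4 \<le> near_const k s R" using R by (simp add: near_const_def)
  have rhs: "0 \<le> near_const k s R * \<delta> powr (s - real k) * (\<delta> / max ?r \<delta>)"
    using C \<delta> by (intro mult_nonneg_nonneg) auto
  have Y1: "sum \<nu> ?S \<le> 1"
  proof -
    have "sum \<nu> ?S \<le> sum \<nu> Y" using Y by (intro sum_mono2) (auto simp: frostman_def)
    then show ?thesis using Y by (simp add: frostman_def)
  qed
  show ?thesis
  proof (cases "?S = {}")
    case True
    then have "sum \<nu> ?S = 0" by (simp only: sum.empty)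
    then show ?thesis using rhs by (simp add: min_le_iff_disj)
  next
    case False
    then obtain x0 z0 where x0: "x0 \<in> Y" and z0: "z0 \<in> Z" "dist x0 z0 < 2 * \<delta>" by auto
    show ?thesis
    proof (cases "4 * \<delta> \<le> ?r")
      case far: True
      have rmax: "max ?r \<delta> = ?r" using far \<delta> by simp
      have r2: "?r \<le> 2 * (R + 1)"
        using x0 z0 Y Z by (intro grassmann_dist_le[OF P Q, of x0 _ z0]) auto
      have "x0 \<in> P" "norm x0 \<le> R" "z0 \<in> Q" using x0 z0(1) Y Z by auto
      then consider "in_thin_slab P Q (2 * \<delta>) (32 * (R + 1) * \<delta> / ?r)"
        | "in_thin_slab Q P (2 * \<delta>) (32 * (R + 1) * \<delta> / ?r)"
        using thin_slab[OF P Q _ _ _ z0(2) \<delta>(1) far R] by blast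
      then show ?thesis
      proof cases
        case 1
        then show ?thesis
          using near_mass_slab[OF P k s R Y, of Z Q ?r] Z \<delta> far r2 rmax by (simp add: min_le_iff_disj)
      next
        case 2
        then show ?thesis
          using near_mass_slab[OF Q k s R Z, of Y P ?r] Y \<delta> far r2 rmax by (simp add: min_le_iff_disj)
      qed
    next
      case near: False
      have "1 = 4 * 1 * (1/4 :: real)" by simp
      also have "\<dots> \<le> near_const k s R * \<delta> powr (s - real k) * (\<delta> / max ?r \<delta>)"
      proof (intro mult_mono C)
        show "1 \<le> \<delta> powr (s - real k)"
          using powr_mono2'[of "s - real k" \<delta> 1] s \<delta> by simp
        show "1 / 4 \<le> \<delta> / max ?r \<delta>"
        proof -
          have "0 < max ?r \<delta>" "max ?r \<delta> \<le> 4 * \<delta>" using near \<delta> by (auto simp: max_def)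
          then show ?thesis by (subst le_divide_eq) (simp del: less_max_iff_disj)
        qed
      qed (use C \<delta> in auto)
      finally show ?thesis using Y1 by linarith
    qed
  qed
qed

text \<open>
  The points of \<open>Z\<close> assigned to the centre \<open>x\<close> lie within \<open>2 \<delta>\<close> of each other and so have mass at most
  \<open>(4 \<delta>) powr s\<close>. If there are any, then all points of \<open>Y\<close> assigned to \<open>x\<close> are \<open>2 \<delta>\<close>-close to \<open>Z\<close>.
\<close>

lemma correlation_one_side:
  assumes Y: "finite Y" "\<And>y. 0 \<le> \<nu> y" and Z: "frostman dist s \<delta> Z \<xi>" and \<delta>: "0 < \<delta>"
    and \<phi>: "finite F" "\<And>y. y \<in> Y \<Longrightarrow> \<phi> y \<in> F \<and> dist (\<phi> y) y < \<delta>"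
    and \<psi>: "\<And>z. z \<in> Z \<Longrightarrow> \<psi> z \<in> F \<and> dist (\<psi> z) z < \<delta>"
  shows "(\<Sum>x\<in>F. sum \<nu> {y\<in>Y. \<phi> y = x} * sum \<xi> {z\<in>Z. \<psi> z = x})
    \<le> (4 * \<delta>) powr s * sum \<nu> {y\<in>Y. \<exists>z\<in>Z. dist y z < 2 * \<delta>}"
proof -
  let ?N = "{y\<in>Y. \<exists>z\<in>Z. dist y z < 2 * \<delta>}"
  have finZ: "finite Z" and \<xi>: "\<And>x. 0 \<le> \<xi> x"
    and ball: "\<And>x r. x \<in> Z \<Longrightarrow> \<delta> \<le> r \<Longrightarrow> sum \<xi> {y\<in>Z. dist x y \<le> r} \<le> (2 * r) powr s"
    using Z by (auto simp: frostman_def)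
  have "sum \<nu> {y\<in>Y. \<phi> y = x} * sum \<xi> {z\<in>Z. \<psi> z = x} \<le> (4 * \<delta>) powr s * sum \<nu> {y\<in>?N. \<phi> y = x}" for x
  proof (cases "{z\<in>Z. \<psi> z = x} = {}")
    case True
    then show ?thesis using Y(2) by (simp only: True) (auto intro!: mult_nonneg_nonneg sum_nonneg)
  next
    case False
    then obtain z0 where z0: "z0 \<in> Z" "\<psi> z0 = x" by auto
    have near: "dist y z0 < 2 * \<delta>" if "dist x y < \<delta>" for y
      using that \<psi>[OF z0(1)] z0(2) dist_triangle_half_r[of x y "2 * \<delta>" z0] by simp
    have "sum \<xi> {z\<in>Z. \<psi> z = x} \<le> sum \<xi> {z\<in>Z. dist z0 z \<le> 2 * \<delta>}"
      using finZ \<psi> near by (intro sum_mono2 \<xi>) (auto simp: dist_commute less_imp_le)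
    also have "\<dots> \<le> (4 * \<delta>) powr s" using ball[OF z0(1), of "2 * \<delta>"] \<delta> by simp
    finally have "sum \<xi> {z\<in>Z. \<psi> z = x} \<le> (4 * \<delta>) powr s" .
    moreover have "{y\<in>Y. \<phi> y = x} \<subseteq> {y\<in>?N. \<phi> y = x}" using \<phi>(2) near z0(1) by blast
    then have "sum \<nu> {y\<in>Y. \<phi> y = x} \<le> sum \<nu> {y\<in>?N. \<phi> y = x}"
      using Y by (intro sum_mono2) auto
    ultimately show ?thesis
      using Y(2) \<xi> by (subst mult.commute, intro mult_mono) (auto intro: sum_nonneg)
  qed
  then have "(\<Sum>x\<in>F. sum \<nu> {y\<in>Y. \<phi> y = x} * sum \<xi> {z\<in>Z. \<psi> z = x})
      \<le> (\<Sum>x\<in>F. (4 * \<delta>) powr s * sum \<nu> {y\<in>?N. \<phi> y = x})"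
    by (intro sum_mono)
  also have "\<dots> = (4 * \<delta>) powr s * (\<Sum>x\<in>F. sum \<nu> {y\<in>?N. \<phi> y = x})"
    by (rule sum_distrib_left[symmetric])
  also have "(\<Sum>x\<in>F. sum \<nu> {y\<in>?N. \<phi> y = x}) = sum \<nu> ?N"
    using Y(1) \<phi> by (intro sum.group) auto
  finally show ?thesis .
qed

lemma correlation:
  fixes P Q :: "'a::euclidean_space set"
  assumes P: "P \<in> affine_grassmannian k" and Q: "Q \<in> affine_grassmannian k" and k: "1 \<le> k"
    and s: "0 < s" "s \<le> real k" and R: "0 \<le> R" and \<delta>: "0 < \<delta>" "\<delta> \<le> 1"
    and Y: "frostman dist s \<delta> Y \<nu>" "Y \<subseteq> P \<inter> cball 0 R"
    and Z: "frostman dist s \<delta> Z \<xi>" "Z \<subseteq> Q \<inter> cball 0 R"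
    and F: "finite F" and \<phi>: "\<And>y. y \<in> Y \<Longrightarrow> \<phi> y \<in> F \<and> dist (\<phi> y) y < \<delta>"
    and \<psi>: "\<And>z. z \<in> Z \<Longrightarrow> \<psi> z \<in> F \<and> dist (\<psi> z) z < \<delta>"
  shows "(\<Sum>x\<in>F. sum \<nu> {y\<in>Y. \<phi> y = x} * sum \<xi> {z\<in>Z. \<psi> z = x})
    \<le> 4 powr s * near_const k s R * \<delta> powr (2 * s - real k) * (\<delta> / max (grassmann_dist P Q) \<delta>)"
proof -
  let ?S = "\<Sum>x\<in>F. sum \<nu> {y\<in>Y. \<phi> y = x} * sum \<xi> {z\<in>Z. \<psi> z = x}"
  let ?a = "sum \<nu> {y\<in>Y. \<exists>z\<in>Z. dist y z < 2 * \<delta>}" and ?b = "sum \<xi> {z\<in>Z. \<exists>y\<in>Y. dist z y < 2 * \<delta>}"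
  have "?S \<le> (4 * \<delta>) powr s * ?a"
    using Y(1) by (intro correlation_one_side[OF _ _ Z(1) \<delta>(1) F \<phi> \<psi>]) (auto simp: frostman_def)
  moreover have "(\<Sum>x\<in>F. sum \<xi> {z\<in>Z. \<psi> z = x} * sum \<nu> {y\<in>Y. \<phi> y = x}) \<le> (4 * \<delta>) powr s * ?b"
    using Z(1) by (intro correlation_one_side[OF _ _ Y(1) \<delta>(1) F \<psi> \<phi>]) (auto simp: frostman_def)
  then have "?S \<le> (4 * \<delta>) powr s * ?b" by (simp add: mult.commute)
  ultimately have "?S \<le> (4 * \<delta>) powr s * min ?a ?b" by (auto simp: min_def)
  also have "\<dots> \<le> (4 * \<delta>) powr s *
      (near_const k s R * \<delta> powr (s - real k) * (\<delta> / max (grassmann_dist P Q) \<delta>))"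
    by (intro mult_left_mono near_mass[OF P Q k s R \<delta> Y Z]) auto
  also have "(4 * \<delta>) powr s = 4 powr s * \<delta> powr s" using \<delta> by (simp add: powr_mult)
  also have "\<dots> * (near_const k s R * \<delta> powr (s - real k) * (\<delta> / max (grassmann_dist P Q) \<delta>))
    = 4 powr s * near_const k s R * (\<delta> powr s * \<delta> powr (s - real k)) * (\<delta> / max (grassmann_dist P Q) \<delta>)"
    by simp
  also have "\<delta> powr s * \<delta> powr (s - real k) = \<delta> powr (2 * s - real k)"
    by (simp flip: powr_add)
  finally show ?thesis .
qed

section \<open>Total boundedness\<close>

lemma finite_net_of_colouring:
  assumes "finite (c ` A)" "\<And>x y. x \<in> A \<Longrightarrow> y \<in> A \<Longrightarrow> c x = c y \<Longrightarrow> D x y"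
  obtains X where "finite X" "X \<subseteq> A" "\<And>a. a \<in> A \<Longrightarrow> \<exists>x\<in>X. D x a"
proof -
  define p where "p k = (SOME a. a \<in> A \<and> c a = k)" for k
  have p: "p (c a) \<in> A \<and> c (p (c a)) = c a" if "a \<in> A" for a
    unfolding p_def by (rule someI[of _ a]) (use that in simp)
  show ?thesis
  proof (rule that[of "p ` c ` A"])
    show "\<exists>x\<in>p ` c ` A. D x a" if "a \<in> A" for a
      using assms(2)[of "p (c a)" a] p[OF that] that by blast
  qed (use assms(1) p in auto)
qed

lemma cball_colouring:
  fixes R :: real
  assumes "0 < \<epsilon>"
  obtains c :: "'a::euclidean_space \<Rightarrow> 'a" where "finite (c ` cball 0 R)"
    "\<And>x y. x \<in> cball 0 R \<Longrightarrow> y \<in> cball 0 R \<Longrightarrow> c x = c y \<Longrightarrow> dist x y < \<epsilon>"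
proof -
  have "compact (cball (0::'a) R)" by simp
  then obtain K where K: "finite K" "cball (0::'a) R \<subseteq> (\<Union>x\<in>K. ball x (\<epsilon> / 2))"
    unfolding compact_eq_totally_bounded using assms half_gt_zero by meson
  define c where "c y = (SOME x. x \<in> K \<and> y \<in> ball x (\<epsilon> / 2))" for y
  have c: "c y \<in> K \<and> y \<in> ball (c y) (\<epsilon> / 2)" if "y \<in> cball 0 R" for y
    unfolding c_def by (rule someI_ex) (use K that in blast)
  show ?thesis
  proof (rule that[of c])
    show "finite (c ` cball 0 R)" using c K(1) by (meson finite_subset image_subsetI)
    show "dist x y < \<epsilon>" if "x \<in> cball 0 R" "y \<in> cball 0 R" "c x = c y" for x y
      using c[OF that(1)] c[OF that(2)] that(3) dist_triangle_half_r[of "c x" x \<epsilon> y] by simp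
  qed
qed

lemma finite_net_euclidean:
  fixes A :: "'a::euclidean_space set"
  assumes "A \<subseteq> cball 0 R" "0 < \<epsilon>"
  obtains X where "finite X" "X \<subseteq> A" "A \<subseteq> (\<Union>x\<in>X. mball_of euclidean_metric x \<epsilon>)"
proof -
  obtain c :: "'a \<Rightarrow> 'a" where c: "finite (c ` cball 0 R)"
    "\<And>x y. x \<in> cball 0 R \<Longrightarrow> y \<in> cball 0 R \<Longrightarrow> c x = c y \<Longrightarrow> dist x y < \<epsilon>"
    by (rule cball_colouring[OF assms(2)]) blast
  have "finite (c ` A)" using c(1) assms(1) by (meson finite_subset image_mono)
  then obtain X where X: "finite X" "X \<subseteq> A" "\<And>a. a \<in> A \<Longrightarrow> \<exists>x\<in>X. dist x a < \<epsilon>"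
    by (rule finite_net_of_colouring[where D = "\<lambda>x y. dist x y < \<epsilon>"]) (use c(2) assms(1) in blast)+
  show ?thesis
  proof (rule that[OF X(1,2)])
    show "A \<subseteq> (\<Union>x\<in>X. mball_of euclidean_metric x \<epsilon>)" using X(3) by auto
  qed
qed

text \<open>
  A plane is described by its offset and the images of the basis vectors under the projection to its
  direction. For planes meeting a fixed ball these finitely many vectors lie in a ball, and planes
  that agree up to \<open>\<eta>\<close> in all of them are close.
\<close>

lemma finite_net_grassmannian:
  fixes \<rho> :: "'a::euclidean_space set metric"
  assumes sp: "mspace \<rho> = affine_grassmannian k"
    and K: "0 < K" "\<And>P Q. P \<in> affine_grassmannian k \<Longrightarrow> Q \<in> affine_grassmannian k \<Longrightarrow>
      mdist \<rho> P Q \<le> K * grassmann_dist P Q"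
    and A: "A \<subseteq> affine_grassmannian k" "\<And>P. P \<in> A \<Longrightarrow> P \<inter> cball 0 R \<noteq> {}" and R: "0 \<le> R" and \<epsilon>: "0 < \<epsilon>"
  obtains X where "finite X" "X \<subseteq> A" "A \<subseteq> (\<Union>P\<in>X. mball_of \<rho> P \<epsilon>)"
proof -
  define n where "n = real DIM('a) + 1"
  have n: "0 < n" by (simp add: n_def add_pos_nonneg)
  define \<eta> where "\<eta> = \<epsilon> / (K * n)"
  have \<eta>: "0 < \<eta>" using K(1) n \<epsilon> by (simp add: \<eta>_def)
  obtain c :: "'a \<Rightarrow> 'a" where c: "finite (c ` cball 0 (R + 1))"
    "\<And>x y. x \<in> cball 0 (R + 1) \<Longrightarrow> y \<in> cball 0 (R + 1) \<Longrightarrow> c x = c y \<Longrightarrow> dist x y < \<eta>"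
    by (rule cball_colouring[OF \<eta>]) blast
  define pr where "pr P = orth_proj (affine_direction P)" for P :: "'a set"
  define col where "col P = (c (affine_offset P), restrict (\<lambda>b. c (pr P b)) Basis)" for P
  have sub: "subspace (affine_direction P)" if "P \<in> A" for P
    using that A(1) by (intro affine_grassmannian_direction_offset(1)[of P k]) auto
  have off: "affine_offset P \<in> cball 0 (R + 1)" if P: "P \<in> A" for P
  proof -
    obtain x where x: "x \<in> P" "norm x \<le> R" using A(2)[OF P] by auto
    have "affine_offset P = x - pr P x"
      unfolding pr_def using P A(1) x by (intro affine_offset_of_mem[of P k]) auto
    then show ?thesis
      using orth_proj_decomp_norm(2)[OF sub[OF P], of x] x by (simp add: pr_def)
  qed
  have prb: "pr P b \<in> cball 0 (R + 1)" if "P \<in> A" "b \<in> Basis" for P b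
    using orth_proj_decomp_norm(1)[OF sub[OF that(1)], of b] that R by (simp add: pr_def)
  have "col ` A \<subseteq> c ` cball 0 (R + 1) \<times> (Basis \<rightarrow>\<^sub>E c ` cball 0 (R + 1))"
    using off prb by (auto simp: col_def)
  moreover have "finite (c ` cball 0 (R + 1) \<times> ((Basis :: 'a set) \<rightarrow>\<^sub>E c ` cball 0 (R + 1)))"
    using c(1) by (intro finite_cartesian_product finite_PiE) auto
  ultimately have "finite (col ` A)" by (rule finite_subset)
  moreover have "mdist \<rho> P Q < \<epsilon>" if PQ: "P \<in> A" "Q \<in> A" and eq: "col P = col Q" for P Q
  proof -
    have PQ': "P \<in> affine_grassmannian k" "Q \<in> affine_grassmannian k" using PQ A(1) by auto
    have o: "norm (affine_offset P - affine_offset Q) < \<eta>"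
      using c(2)[OF off[OF PQ(1)] off[OF PQ(2)]] eq by (simp add: col_def dist_norm)
    have p: "norm (pr P b - pr Q b) \<le> \<eta>" if b: "b \<in> Basis" for b
    proof -
      have "c (pr P b) = c (pr Q b)" using eq b by (auto simp: col_def dest: fun_cong[of _ _ b])
      then show ?thesis using c(2)[OF prb[OF PQ(1) b] prb[OF PQ(2) b]] by (simp add: dist_norm less_imp_le)
    qed
    have "onorm (\<lambda>x. pr P x - pr Q x) \<le> (\<Sum>b\<in>Basis. norm (pr P b - pr Q b))"
      unfolding pr_def by (intro onorm_componentwise bounded_linear_orth_proj_diff sub PQ)
    also have "\<dots> \<le> real DIM('a) * \<eta>" by (rule sum_bounded_above) (rule p)
    finally have "grassmann_dist P Q < n * \<eta>"
      using o by (simp add: grassmann_dist_def pr_def n_def algebra_simps)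
    then have "K * grassmann_dist P Q < K * (n * \<eta>)" using K(1) by simp
    also have "K * (n * \<eta>) = \<epsilon>" using K(1) n by (simp add: \<eta>_def)
    finally show ?thesis using K(2)[OF PQ'] by simp
  qed
  ultimately obtain X where X: "finite X" "X \<subseteq> A" "\<And>P. P \<in> A \<Longrightarrow> \<exists>Q\<in>X. mdist \<rho> Q P < \<epsilon>"
    using finite_net_of_colouring[where c = col and A = A and D = "\<lambda>P Q. mdist \<rho> P Q < \<epsilon>"] by blast
  show ?thesis
  proof (rule that[OF X(1,2)])
    show "A \<subseteq> (\<Union>P\<in>X. mball_of \<rho> P \<epsilon>)"
    proof
      fix P assume "P \<in> A"
      then obtain Q where "Q \<in> X" "mdist \<rho> Q P < \<epsilon>" using X(3) by blast
      then show "P \<in> (\<Union>P\<in>X. mball_of \<rho> P \<epsilon>)"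
        using \<open>P \<in> A\<close> A(1) X(2) sp by (intro UN_I[of Q]) auto
    qed
  qed
qed

section \<open>The estimate at a single scale\<close>

text \<open>
  The map \<open>\<phi>\<close> assigns every point to a single ball, although the balls may overlap; so pushing \<open>\<nu>\<close>
  forward to the centres preserves the total mass.
\<close>

lemma frostman_on_plane:
  fixes P :: "'a::euclidean_space set"
  assumes s: "0 < s" and \<kappa>: "0 \<le> \<kappa>" "\<kappa> \<le> 1"
    and cont: "ennreal \<kappa> \<le> ball_content euclidean_metric s (P \<inter> cball 0 R \<inter> (\<Union>x\<in>F. ball x ((1/2)^l)))"
  shows "\<exists>Y \<nu> \<phi>. frostman dist s ((1/2)^l) Y \<nu> \<and> sum \<nu> Y = \<kappa> / 4 powr s \<and> Y \<subseteq> P \<inter> cball 0 R \<and>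
    (\<forall>y\<in>Y. \<phi> y \<in> F \<and> dist (\<phi> y) y < (1/2)^l)"
proof -
  let ?A = "P \<inter> cball 0 R \<inter> (\<Union>x\<in>F. ball x ((1/2)^l))"
  have "?A \<subseteq> cball 0 R" by auto
  then obtain Y where Y: "finite Y" "Y \<subseteq> ?A" "?A \<subseteq> (\<Union>x\<in>Y. mball_of euclidean_metric x ((1/2)^l))"
    by (rule finite_net_euclidean[of ?A R "(1/2)^l"]) auto
  from discrete_Frostman[OF s Y(1) _ Y(3) \<kappa> cont] obtain \<nu> where
    \<nu>: "frostman dist s ((1/2)^l) Y \<nu>" "sum \<nu> Y = \<kappa> / 4 powr s"
    by auto
  have "\<exists>x. x \<in> F \<and> dist x y < (1/2)^l" if "y \<in> Y" for y
  proof -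
    have "y \<in> (\<Union>x\<in>F. ball x ((1/2)^l))" using Y(2) that by blast
    then show ?thesis by auto
  qed
  then have "\<forall>y\<in>Y. \<exists>x. x \<in> F \<and> dist x y < (1/2)^l" by blast
  then obtain \<phi> where "\<forall>y\<in>Y. \<phi> y \<in> F \<and> dist (\<phi> y) y < (1/2)^l" by metis
  then show ?thesis using \<nu> Y(2) by (intro exI[of _ Y] exI[of _ \<nu>] exI[of _ \<phi>]) auto
qed

text \<open>
  The second moment estimate. The left side is the square of the total mass of
  \<open>\<Sum>P. \<mu> P * \<nu>\<^sub>P\<close>, pushed forward to the centres. The Frostman measure \<open>\<mu>\<close> refers to \<open>\<rho>\<close> while the
  correlation bound refers to the standard distance, which costs the factor \<open>max 1 K\<close>.
\<close>

lemma single_scale: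
  fixes \<rho> :: "'a::euclidean_space set metric"
  defines "\<delta> \<equiv> \<lambda>l. (1/2::real)^l"
  assumes sp: "mspace \<rho> = affine_grassmannian k"
    and K: "0 < K" "\<And>P Q. P \<in> affine_grassmannian k \<Longrightarrow> Q \<in> affine_grassmannian k \<Longrightarrow>
      mdist \<rho> P Q \<le> K * grassmann_dist P Q"
    and k: "1 \<le> k" and s: "0 < s" "s \<le> real k" and t: "0 < t" "t \<le> 1" and R: "0 \<le> R"
    and \<kappa>: "0 < \<kappa>" "\<kappa> \<le> 1" and E: "E \<subseteq> affine_grassmannian k" "ennreal \<kappa> \<le> ball_content \<rho> t E"
    and F: "finite F"
    and cont: "\<And>P. P \<in> E \<Longrightarrow>
      ennreal \<kappa> \<le> ball_content euclidean_metric s (P \<inter> cball 0 R \<inter> (\<Union>x\<in>F. ball x (\<delta> l)))"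
  shows "(\<kappa>\<^sup>2 / 4 powr (s + t))\<^sup>2 \<le> real (card F) *
    ((4 powr s * near_const k s R * max 1 K) * (4 * real l + 5) * \<delta> l powr (2 * s - real k + t))"
proof -
  define d where "d = \<delta> l"
  have d: "0 < d" "d \<le> 1" by (auto simp: d_def \<delta>_def power_le_one)
  have "P \<inter> cball 0 R \<noteq> {}" if "P \<in> E" for P
    using cont[OF that] \<kappa>(1) by (auto simp: ennreal_le_iff2)
  from finite_net_grassmannian[OF sp K E(1) this R, of "(1/2)^l"]
  obtain X where X: "finite X" "X \<subseteq> E" "E \<subseteq> (\<Union>P\<in>X. mball_of \<rho> P ((1/2)^l))" by auto
  have "X \<subseteq> mspace \<rho>" using X(2) E(1) sp by auto
  then obtain \<mu> where \<mu>: "frostman (mdist \<rho>) t d X \<mu>" "sum \<mu> X = \<kappa> / 4 powr t"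
    using discrete_Frostman[OF t(1) X(1) _ X(3) less_imp_le[OF \<kappa>(1)] \<kappa>(2) E(2)]
    unfolding d_def \<delta>_def by blast
  have \<mu>0: "0 \<le> \<mu> P" and \<mu>1: "sum \<mu> X \<le> 1" for P using \<mu>(1) by (auto simp: frostman_def)
  have "\<forall>P\<in>X. \<exists>T. frostman dist s d (fst T) (fst (snd T)) \<and> sum (fst (snd T)) (fst T) = \<kappa> / 4 powr s \<and>
      fst T \<subseteq> P \<inter> cball 0 R \<and> (\<forall>y\<in>fst T. snd (snd T) y \<in> F \<and> dist (snd (snd T) y) y < d)"
  proof
    fix P assume "P \<in> X"
    then have "P \<in> E" using X(2) by auto
    from frostman_on_plane[OF s(1) less_imp_le[OF \<kappa>(1)] \<kappa>(2) cont[OF this, unfolded \<delta>_def]]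
    obtain Y \<nu> \<phi> where "frostman dist s d Y \<nu>" "sum \<nu> Y = \<kappa> / 4 powr s" "Y \<subseteq> P \<inter> cball 0 R"
      "\<forall>y\<in>Y. \<phi> y \<in> F \<and> dist (\<phi> y) y < d" unfolding d_def \<delta>_def by blast
    then show "\<exists>T. frostman dist s d (fst T) (fst (snd T)) \<and> sum (fst (snd T)) (fst T) = \<kappa> / 4 powr s \<and>
      fst T \<subseteq> P \<inter> cball 0 R \<and> (\<forall>y\<in>fst T. snd (snd T) y \<in> F \<and> dist (snd (snd T) y) y < d)"
      by (intro exI[of _ "(Y, \<nu>, \<phi>)"]) simp
  qed
  then obtain T where T: "\<forall>P\<in>X. frostman dist s d (fst (T P)) (fst (snd (T P))) \<and>
      sum (fst (snd (T P))) (fst (T P)) = \<kappa> / 4 powr s \<and>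
      fst (T P) \<subseteq> P \<inter> cball 0 R \<and>
      (\<forall>y\<in>fst (T P). snd (snd (T P)) y \<in> F \<and> dist (snd (snd (T P)) y) y < d)"
    by (rule bchoice[THEN exE])
  define Y where "Y P = fst (T P)" for P
  define \<nu> where "\<nu> P = fst (snd (T P))" for P
  define \<phi> where "\<phi> P = snd (snd (T P))" for P
  have Y: "frostman dist s d (Y P) (\<nu> P)" "sum (\<nu> P) (Y P) = \<kappa> / 4 powr s" "Y P \<subseteq> P \<inter> cball 0 R"
    "\<And>y. y \<in> Y P \<Longrightarrow> \<phi> P y \<in> F \<and> dist (\<phi> P y) y < d" if "P \<in> X" for P
    using T that unfolding Y_def \<nu>_def \<phi>_def by blast+
  define g where "g P x = sum (\<nu> P) {y\<in>Y P. \<phi> P y = x}" for P x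
  have gsum: "(\<Sum>x\<in>F. g P x) = \<kappa> / 4 powr s" if "P \<in> X" for P
  proof -
    have "(\<Sum>x\<in>F. g P x) = sum (\<nu> P) (Y P)"
      unfolding g_def using F Y(1)[OF that] Y(4)[OF that] by (intro sum.group) (auto simp: frostman_def)
    then show ?thesis using Y(2)[OF that] by simp
  qed
  define C where "C = 4 powr s * near_const k s R"
  have C: "0 \<le> C" using R by (simp add: C_def near_const_def)
  define L where "L = max 1 K"
  have L: "1 \<le> L" "K \<le> L" by (auto simp: L_def)
  have corr: "(\<Sum>x\<in>F. g P x * g Q x) \<le> C * L * d powr (2 * s - real k) * (d / max (mdist \<rho> P Q) d)"
    if PQ: "P \<in> X" "Q \<in> X" for P Q
  proof -
    have G: "P \<in> affine_grassmannian k" "Q \<in> affine_grassmannian k" using PQ X(2) E(1) by auto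
    have "(\<Sum>x\<in>F. g P x * g Q x) \<le> C * d powr (2 * s - real k) * (d / max (grassmann_dist P Q) d)"
      unfolding g_def C_def
      by (rule correlation[OF G k s R d Y(1)[OF PQ(1)] Y(3)[OF PQ(1)] Y(1)[OF PQ(2)] Y(3)[OF PQ(2)]
            F Y(4)[OF PQ(1)] Y(4)[OF PQ(2)]])
    also have "d / max (grassmann_dist P Q) d \<le> L * (d / max (mdist \<rho> P Q) d)"
    proof -
      have "mdist \<rho> P Q \<le> K * grassmann_dist P Q" by (rule K(2)[OF G])
      also have "\<dots> \<le> K * max (grassmann_dist P Q) d" using K(1) by (intro mult_left_mono) auto
      also have "\<dots> \<le> L * max (grassmann_dist P Q) d" using L d by (intro mult_right_mono) (auto simp: max_def)
      finally have "mdist \<rho> P Q \<le> L * max (grassmann_dist P Q) d" .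
      moreover have "1 * d \<le> L * max (grassmann_dist P Q) d" using L d by (intro mult_mono) auto
      ultimately have m: "max (mdist \<rho> P Q) d \<le> L * max (grassmann_dist P Q) d" by simp
      have p: "0 < max (mdist \<rho> P Q) d" "0 < max (grassmann_dist P Q) d" using d by auto
      have "d * max (mdist \<rho> P Q) d \<le> d * (L * max (grassmann_dist P Q) d)"
        using m d by (intro mult_left_mono) auto
      then show ?thesis using p by (simp add: field_simps del: max_less_iff_conj less_max_iff_disj)
    qed
    then have "C * d powr (2 * s - real k) * (d / max (grassmann_dist P Q) d)
        \<le> C * d powr (2 * s - real k) * (L * (d / max (mdist \<rho> P Q) d))"
      using C by (intro mult_left_mono) auto
    finally show ?thesis by (simp add: mult_ac)
  qed
  have "\<kappa>\<^sup>2 / 4 powr (s + t) = \<kappa> / 4 powr t * (\<kappa> / 4 powr s)"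
    by (simp add: powr_add power2_eq_square)
  also have "\<dots> = (\<Sum>P\<in>X. \<mu> P * (\<Sum>x\<in>F. g P x))"
    unfolding \<mu>(2)[symmetric] sum_distrib_right by (intro sum.cong) (simp_all add: gsum)
  finally have "(\<kappa>\<^sup>2 / 4 powr (s + t))\<^sup>2 \<le> real (card F) *
      (\<Sum>P\<in>X. \<Sum>Q\<in>X. \<mu> P * \<mu> Q * (\<Sum>x\<in>F. g P x * g Q x))"
    using sum_squared_le_card_sum_correlations[of \<mu> g F X] by simp
  also have "(\<Sum>P\<in>X. \<Sum>Q\<in>X. \<mu> P * \<mu> Q * (\<Sum>x\<in>F. g P x * g Q x))
      \<le> (\<Sum>P\<in>X. \<Sum>Q\<in>X. \<mu> P * \<mu> Q * (C * L * d powr (2 * s - real k) * (d / max (mdist \<rho> P Q) d)))"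
    using \<mu>0 by (intro sum_mono mult_left_mono corr) auto
  also have "\<dots> = C * L * d powr (2 * s - real k) *
      (\<Sum>P\<in>X. \<mu> P * (\<Sum>Q\<in>X. \<mu> Q * (d / max (mdist \<rho> P Q) d)))"
    by (simp add: sum_distrib_left mult_ac)
  also have "\<dots> \<le> C * L * d powr (2 * s - real k) * (\<Sum>P\<in>X. \<mu> P * ((4 * real l + 5) * d powr t))"
    using C L \<mu>0 Frostman_energy[OF t \<mu>(1)[unfolded d_def \<delta>_def]]
    by (intro mult_left_mono sum_mono) (auto simp: d_def \<delta>_def)
  also have "\<dots> = C * L * d powr (2 * s - real k) * (((4 * real l + 5) * d powr t) * sum \<mu> X)"
    by (simp only: sum_distrib_right[symmetric] mult.commute[of "sum \<mu> X"])
  also have "\<dots> \<le> C * L * d powr (2 * s - real k) * (((4 * real l + 5) * d powr t) * 1)"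
    using C L \<mu>1 by (intro mult_left_mono) auto
  also have "\<dots> = C * L * (4 * real l + 5) * (d powr (2 * s - real k) * d powr t)"
    by (simp add: mult_ac)
  also have "d powr (2 * s - real k) * d powr t = d powr (2 * s - real k + t)"
    by (simp add: powr_add)
  finally show ?thesis
    unfolding C_def L_def d_def by (simp add: mult_left_mono)
qed

section \<open>Assembling the scales\<close>

text \<open>
  The sum of the \<open>u\<close>-th powers of the radii in a cover of small content bounds both the radii, so that
  only levels \<open>l \<ge> l\<^sub>0\<close> occur, and the number of balls of each dyadic size.
\<close>

lemma dyadic_cover:
  fixes B :: "'a::euclidean_space set"
  assumes u: "0 < u" and B: "ball_content euclidean_metric u B = 0"
  obtains F :: "nat \<Rightarrow> 'a set" where "\<And>l. finite (F l)" "\<And>l. l < l\<^sub>0 \<Longrightarrow> F l = {}"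
    "\<And>l. real (card (F l)) \<le> 2 powr u * 2 powr (real l * u)"
    "B \<subseteq> (\<Union>l. \<Union>x\<in>F l. ball x ((1/2)^l))"
proof -
  define \<epsilon> where "\<epsilon> = ((1/2::real)^l\<^sub>0) powr u"
  have \<epsilon>: "0 < \<epsilon>" "\<epsilon> \<le> 1" using u by (auto simp: \<epsilon>_def power_le_one intro!: powr_le1)
  then have "ball_content euclidean_metric u B < ennreal \<epsilon>" using B by simp
  then obtain x :: "nat \<Rightarrow> 'a" and r where r: "\<And>i::nat. 0 \<le> r i"
    and cov: "B \<subseteq> (\<Union>i. mball_of euclidean_metric (x i) (r i))"
    and sm: "(\<Sum>i. ennreal (r i powr u)) < ennreal \<epsilon>"
    by (rule ball_content_lessE) blast
  have fin_sum: "(\<Sum>i\<in>J. r i powr u) < \<epsilon>" if "finite J" for J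
  proof -
    have "ennreal (\<Sum>i\<in>J. r i powr u) = (\<Sum>i\<in>J. ennreal (r i powr u))" by simp
    also have "\<dots> \<le> (\<Sum>i. ennreal (r i powr u))"
      using that by (intro sum_le_suminf summableI) auto
    also note sm
    finally show ?thesis by (subst (asm) ennreal_less_iff) (auto intro: sum_nonneg)
  qed
  have r_less: "r i < (1/2)^l\<^sub>0" for i
  proof (rule ccontr)
    assume "\<not> r i < (1/2)^l\<^sub>0"
    then have "\<epsilon> \<le> r i powr u" unfolding \<epsilon>_def using u by (intro powr_mono2) auto
    then show False using fin_sum[of "{i}"] by simp
  qed
  define I where "I l = {i. r i < (1/2)^l \<and> (1/2)^l \<le> 2 * r i}" for l :: nat
  have card_I: "real (card J) \<le> 2 powr u * 2 powr (real l * u)" if "J \<subseteq> I l" "finite J" for J l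
  proof -
    define q where "q = (1/2 * (1/2::real)^l) powr u"
    have q: "q = inverse (2 powr u * 2 powr (real l * u))"
      by (simp add: q_def powr_mult powr_powr power_one_over powr_divide inverse_eq_divide flip: powr_realpow)
    have "real (card J) * q = (\<Sum>i\<in>J. q)" by simp
    also have "\<dots> \<le> (\<Sum>i\<in>J. r i powr u)"
      unfolding q_def using that u by (intro sum_mono powr_mono2) (auto simp: I_def)
    also have "\<dots> \<le> 1" using fin_sum[OF that(2)] \<epsilon> by simp
    finally show ?thesis unfolding q by (simp add: field_simps)
  qed
  have fin_I: "finite (I l)" for l
  proof (rule ccontr)
    assume inf: "infinite (I l)"
    obtain n :: nat where n: "2 powr u * 2 powr (real l * u) < real n" using reals_Archimedean2 by blast
    obtain J where "J \<subseteq> I l" "finite J" "card J = n" using infinite_arbitrarily_large[OF inf] by blast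
    then show False using card_I[of J l] n by simp
  qed
  show ?thesis
  proof (rule that[of "\<lambda>l. x ` I l"])
    show "finite (x ` I l)" for l using fin_I by simp
    show "real (card (x ` I l)) \<le> 2 powr u * 2 powr (real l * u)" for l
      using card_I[OF subset_refl fin_I, of l] card_image_le[OF fin_I, of x l] by linarith
    show "x ` I l = {}" if "l < l\<^sub>0" for l
    proof -
      have "i \<notin> I l" for i
      proof
        assume "i \<in> I l"
        then have "(1/2::real)^l < 2 * (1/2)^l\<^sub>0" using r_less[of i] by (simp add: I_def)
        moreover have "(1/2::real)^l\<^sub>0 \<le> (1/2)^Suc l" using that by (intro power_decreasing) auto
        ultimately show False by simp
      qed
      then show ?thesis by blast
    qed
    show "B \<subseteq> (\<Union>l. \<Union>x\<in>x ` I l. ball x ((1/2)^l))"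
    proof
      fix b assume "b \<in> B"
      then obtain i where i: "dist (x i) b < r i" using cov by auto
      have "0 < r i" using i zero_le_dist[of "x i" b] by linarith
      moreover have "r i < 1" using r_less[of i] power_le_one[of "1/2::real" l\<^sub>0] by simp
      ultimately obtain l where "r i < (1/2)^l" "(1/2)^l \<le> 2 * r i" by (rule dyadic_scale)
      then show "b \<in> (\<Union>l. \<Union>x\<in>x ` I l. ball x ((1/2)^l))"
        using i by (intro UN_I[of l] UN_I[of "x i"]) (auto simp: I_def)
    qed
  qed
qed

lemma ennreal_pos_real_below:
  assumes "0 < (x::ennreal)"
  obtains c :: real where "0 < c" "c \<le> 1" "ennreal c < x"
proof -
  obtain y where y: "0 < y" "y < x" using dense[OF assms] by blast
  then have "y < top" using less_top_ennreal le_less_trans top_greatest by (metis less_le_trans)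
  then obtain d where d: "0 \<le> d" "y = ennreal d" by (auto simp: less_top_ennreal)
  then have "0 < d" using y by simp
  show ?thesis
  proof (rule that[of "min d 1"])
    have "ennreal (min d 1) \<le> y" unfolding d(2) by (rule ennreal_leI) simp
    then show "ennreal (min d 1) < x" using y(2) by (rule le_less_trans)
  qed (use \<open>0 < d\<close> in auto)
qed

text \<open>
  Both the size of the ball and the lower bound for the content can be made independent of the plane,
  because \<open>E\<close> is a countable union of subfamilies on which such bounds hold.
\<close>

lemma uniform_content:
  fixes B :: "'a::euclidean_space set"
  assumes E: "0 < ball_content \<rho> t E"
    and EB: "\<And>P. P \<in> E \<Longrightarrow> 0 < ball_content euclidean_metric s (P \<inter> B)"
  obtains c R E' where "0 < c" "c \<le> 1" "0 \<le> R" "E' \<subseteq> E" "ennreal c < ball_content \<rho> t E'"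
    "\<And>P. P \<in> E' \<Longrightarrow> ennreal c < ball_content euclidean_metric s (P \<inter> cball 0 R \<inter> B)"
proof -
  let ?cont = "\<lambda>P m. ball_content euclidean_metric s (P \<inter> cball 0 (real m) \<inter> B)"
  define A where "A m = {P\<in>E. ennreal (1 / (real m + 1)) < ?cont P m}" for m
  have "E \<subseteq> (\<Union>m. A m)"
  proof
    fix P assume P: "P \<in> E"
    have "P \<inter> B \<subseteq> (\<Union>m. P \<inter> cball 0 (real m) \<inter> B)" using real_arch_simple by auto
    then have "0 < ball_content euclidean_metric s (\<Union>m. P \<inter> cball 0 (real m) \<inter> B)"
      using EB[OF P] ball_content_mono by (metis less_le_trans)
    then obtain n where "0 < ?cont P n" by (rule ball_content_pos_UN)
    then obtain c where c: "0 < c" "ennreal c < ?cont P n" by (rule ennreal_pos_real_below) blast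
    obtain n' :: nat where n': "1 / c < real n'" using reals_Archimedean2 by blast
    define m where "m = max n n'"
    have "1 / c < real m + 1" using n' by (simp add: m_def)
    then have "1 / (real m + 1) \<le> c" using c(1) by (simp add: field_simps)
    then have "ennreal (1 / (real m + 1)) \<le> ennreal c" by (rule ennreal_leI)
    also have "\<dots> < ?cont P n" by (rule c(2))
    also have "\<dots> \<le> ?cont P m" by (rule ball_content_mono) (auto simp: m_def)
    finally show "P \<in> (\<Union>m. A m)" using P by (auto simp: A_def)
  qed
  then have "0 < ball_content \<rho> t (\<Union>m. A m)" using E ball_content_mono by (metis less_le_trans)
  then obtain m where "0 < ball_content \<rho> t (A m)" by (rule ball_content_pos_UN)
  then obtain c where c: "0 < c" "c \<le> 1" "ennreal c < ball_content \<rho> t (A m)"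
    by (rule ennreal_pos_real_below) blast
  let ?c = "min c (1 / (real m + 1))"
  show ?thesis
  proof (rule that[of ?c "real m" "A m"])
    show "A m \<subseteq> E" by (auto simp: A_def)
    have "ennreal ?c \<le> ennreal c" by (intro ennreal_leI) simp
    then show "ennreal ?c < ball_content \<rho> t (A m)" using c(3) by (rule le_less_trans)
    fix P assume "P \<in> A m"
    then have "ennreal (1 / (real m + 1)) < ?cont P m" by (simp add: A_def)
    moreover have "ennreal ?c \<le> ennreal (1 / (real m + 1))" by (intro ennreal_leI) simp
    ultimately show "ennreal ?c < ?cont P m" by (rule le_less_trans[rotated])
  qed (use c in auto)
qed

text \<open>
  The pigeonhole principle is applied twice: for a fixed plane \<open>P\<close>, to the pieces of \<open>P \<inter> B\<close> covered at
  the different dyadic levels, and then to the subfamilies of planes for which a given level succeeds.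
  The level found is at least \<open>l\<^sub>0\<close>, since lower levels of the cover are empty, and \<open>l\<^sub>0\<close> is chosen
  so that \<open>single_scale\<close> fails from there on.
\<close>

lemma ball_content_lower_bound:
  fixes \<rho> :: "'a::euclidean_space set metric"
  assumes nat: "natural_metric k \<rho>" and k: "1 \<le> k"
    and s: "0 < s" "s \<le> real k" and t: "0 < t" "t \<le> 1" and u: "0 < u" "u < 2 * s - real k + t"
    and EG: "E \<subseteq> affine_grassmannian k" and E: "0 < ball_content \<rho> t E"
    and EB: "\<And>P. P \<in> E \<Longrightarrow> 0 < ball_content euclidean_metric s (P \<inter> B)"
  shows "0 < ball_content euclidean_metric u B"
proof (rule ccontr)
  assume "\<not> 0 < ball_content euclidean_metric u B"
  then have B0: "ball_content euclidean_metric u B = 0" by simp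
  obtain c R E' where c: "0 < c" "c \<le> 1" and R: "0 \<le> R" and E': "E' \<subseteq> E" "ennreal c < ball_content \<rho> t E'"
    and E'B: "\<And>P. P \<in> E' \<Longrightarrow> ennreal c < ball_content euclidean_metric s (P \<inter> cball 0 R \<inter> B)"
    by (rule uniform_content[OF E EB]) blast+
  obtain K where sp: "mspace \<rho> = affine_grassmannian k" and K: "0 < K"
    "\<And>P Q. P \<in> affine_grassmannian k \<Longrightarrow> Q \<in> affine_grassmannian k \<Longrightarrow>
      mdist \<rho> P Q \<le> K * grassmann_dist P Q"
    using nat unfolding natural_metric_def by blast
  define \<gamma> where "\<gamma> = 2 * s - real k + t - u"
  have \<gamma>: "0 < \<gamma>" using u by (simp add: \<gamma>_def)
  define w where "w l = c / (2 * (real l + 1)\<^sup>2)" for l :: nat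
  define C where "C = 2 powr u * (4 powr s * near_const k s R * max 1 K)"
  \<comment> \<open>\<open>a / (l + 1)\<^sup>8\<close> is the left side of \<open>single_scale\<close> for the content bound \<open>w l\<close>\<close>
  define a where "a = (c\<^sup>2 / (4 * 4 powr (s + t)))\<^sup>2"
  have a: "0 < a" using c by (simp add: a_def)
  have "((\<lambda>l::nat. C * ((4 * real l + 5) * (real l + 1)^8 * 2 powr (- \<gamma> * real l))) \<longlongrightarrow> C * 0) sequentially"
    by (intro tendsto_mult tendsto_const) (use \<gamma> in real_asymp)
  then have "\<forall>\<^sub>F l in sequentially. C * ((4 * real l + 5) * (real l + 1)^8 * 2 powr (- \<gamma> * real l)) < a"
    using a by (intro order_tendstoD(2)[of _ "C * 0"]) auto
  then obtain l\<^sub>0 where l\<^sub>0: "\<And>l. l\<^sub>0 \<le> l \<Longrightarrow> C * ((4 * real l + 5) * (real l + 1)^8 * 2 powr (- \<gamma> * real l)) < a"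
    by (auto simp: eventually_sequentially)
  obtain F :: "nat \<Rightarrow> 'a set" where F: "\<And>l. finite (F l)" "\<And>l. l < l\<^sub>0 \<Longrightarrow> F l = {}"
    "\<And>l. real (card (F l)) \<le> 2 powr u * 2 powr (real l * u)"
    "B \<subseteq> (\<Union>l. \<Union>x\<in>F l. ball x ((1/2)^l))"
    by (rule dyadic_cover[OF u(1) B0, of l\<^sub>0]) blast
  define U where "U l = (\<Union>x\<in>F l. ball x ((1/2)^l))" for l
  define E'' where "E'' l = {P\<in>E'. ennreal (w l) \<le> ball_content euclidean_metric s (P \<inter> cball 0 R \<inter> U l)}" for l
  have "E' \<subseteq> (\<Union>l. E'' l)"
  proof
    fix P assume P: "P \<in> E'"
    have "P \<inter> cball 0 R \<inter> B \<subseteq> (\<Union>l. P \<inter> cball 0 R \<inter> U l)" using F(4) unfolding U_def by blast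
    from ball_content_pigeonhole[OF E'B[OF P] this c(1)] obtain l
      where "ennreal (w l) \<le> ball_content euclidean_metric s (P \<inter> cball 0 R \<inter> U l)"
      unfolding w_def by blast
    then show "P \<in> (\<Union>l. E'' l)" using P by (auto simp: E''_def)
  qed
  from ball_content_pigeonhole[OF E'(2) this c(1)] obtain l where l: "ennreal (w l) \<le> ball_content \<rho> t (E'' l)"
    unfolding w_def by blast
  have w: "0 < w l" using c by (simp add: w_def)
  have w1: "w l \<le> 1"
  proof -
    have "1 \<le> (real l + 1)\<^sup>2" by (rule one_le_power) simp
    then have "1 \<le> 2 * (real l + 1)\<^sup>2" by linarith
    then show ?thesis using c by (simp add: w_def divide_le_eq)
  qed
  have "E'' l \<noteq> {}"
    using l w by (auto simp: ennreal_le_iff2)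
  then obtain P where "P \<in> E'' l" by blast
  then have "ennreal (w l) \<le> ball_content euclidean_metric s (P \<inter> cball 0 R \<inter> U l)" by (simp add: E''_def)
  then have "U l \<noteq> {}" using w by (auto simp: ennreal_le_iff2)
  then have l0: "l\<^sub>0 \<le> l" using F(2)[of l] by (cases "l < l\<^sub>0") (auto simp: U_def)
  have "((w l)\<^sup>2 / 4 powr (s + t))\<^sup>2 \<le> real (card (F l)) *
      ((4 powr s * near_const k s R * max 1 K) * (4 * real l + 5) * ((1/2)^l) powr (2 * s - real k + t))"
  proof (rule single_scale[OF sp K k s t R w w1 _ l F(1)])
    show "E'' l \<subseteq> affine_grassmannian k" using EG E'(1) by (auto simp: E''_def)
  qed (auto simp: E''_def U_def)
  also have "\<dots> \<le> (2 powr u * 2 powr (real l * u)) *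
      ((4 powr s * near_const k s R * max 1 K) * (4 * real l + 5) * ((1/2)^l) powr (2 * s - real k + t))"
    using R by (intro mult_right_mono F(3)) (auto simp: near_const_def)
  also have "((1/2::real)^l) powr (2 * s - real k + t) = 2 powr (- real l * (2 * s - real k + t))"
    by (simp add: powr_powr powr_minus inverse_eq_divide power_one_over powr_divide flip: powr_realpow)
  also have "(2 powr u * 2 powr (real l * u)) *
      ((4 powr s * near_const k s R * max 1 K) * (4 * real l + 5) * 2 powr (- real l * (2 * s - real k + t)))
    = C * ((4 * real l + 5) * (2 powr (real l * u) * 2 powr (- real l * (2 * s - real k + t))))"
    by (simp add: C_def)
  also have "2 powr (real l * u) * 2 powr (- real l * (2 * s - real k + t)) = 2 powr (- \<gamma> * real l)"
    by (simp add: \<gamma>_def algebra_simps flip: powr_add)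
  finally have "((w l)\<^sup>2 / 4 powr (s + t))\<^sup>2 * (real l + 1)^8
      \<le> C * ((4 * real l + 5) * 2 powr (- \<gamma> * real l)) * (real l + 1)^8"
    by (rule mult_right_mono) simp
  also have "\<dots> < a" using l\<^sub>0[OF l0] by (simp add: mult_ac)
  also have "((w l)\<^sup>2 / 4 powr (s + t))\<^sup>2 * (real l + 1)^8 = a"
  proof -
    have "real l + 1 \<noteq> 0" by simp
    then show ?thesis by (simp add: w_def a_def power_divide power_mult_distrib flip: power_mult)
  qed
  finally show False by simp
qed

lemma hausdorff_dim_nonneg: "0 \<le> hausdorff_dim m A"
  unfolding hausdorff_dim_def by (intro INF_greatest) auto

text \<open>
  If \<open>dim E = 0\<close>, a single plane suffices, as \<open>\<alpha> \<ge> 2 \<alpha> - k\<close>. Otherwise, a failure of the inequality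
  leaves room for positive \<open>s < \<alpha>\<close>, \<open>t < min (dim E) 1\<close> and \<open>u > dim B\<close> with \<open>u < 2 s - k + t\<close>. The
  \<open>u\<close>-dimensional content of \<open>B\<close> would then be both zero and positive.
\<close>

theorem theorem2p1:
  fixes k :: nat
    and \<alpha> :: real
    and B :: "(real ^ 'n) set"
    and E :: "(real ^ 'n) set set"
    and \<rho> :: "(real ^ 'n) set metric"
  assumes "1 \<le> k" and "k < CARD('n)"
    and "0 < \<alpha>" and "\<alpha> \<le> real k"
    and "natural_metric k \<rho>"
    and "E \<noteq> {}" and "E \<subseteq> affine_grassmannian k"
    and "\<And>P. P \<in> E \<Longrightarrow> ereal \<alpha> \<le> hausdorff_dim euclidean_metric (P \<inter> B)"
  shows "ereal (2 * \<alpha> - real k) + min (hausdorff_dim \<rho> E) 1 \<le> hausdorff_dim euclidean_metric B"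
proof -
  define e where "e = real_of_ereal (min (hausdorff_dim \<rho> E) 1)"
  have "0 \<le> min (hausdorff_dim \<rho> E) 1" "min (hausdorff_dim \<rho> E) 1 \<le> 1"
    using hausdorff_dim_nonneg[of \<rho> E] by auto
  then have e: "min (hausdorff_dim \<rho> E) 1 = ereal e" "0 \<le> e" "e \<le> 1"
    unfolding e_def by (cases "min (hausdorff_dim \<rho> E) 1"; simp)+
  have "ereal (2 * \<alpha> - real k + e) \<le> hausdorff_dim euclidean_metric B"
  proof (cases "e = 0")
    case True
    obtain P where "P \<in> E" using assms(6) by blast
    have "ereal (2 * \<alpha> - real k + e) \<le> ereal \<alpha>" using True assms(4) by simp
    also have "\<dots> \<le> hausdorff_dim euclidean_metric (P \<inter> B)" by (rule assms(8)[OF \<open>P \<in> E\<close>])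
    also have "\<dots> \<le> hausdorff_dim euclidean_metric B" by (rule hausdorff_dim_mono) simp
    finally show ?thesis .
  next
    case False
    then have e0: "0 < e" using e by simp
    show ?thesis
    proof (rule ccontr)
      assume "\<not> ?thesis"
      then obtain \<beta> where \<beta>: "hausdorff_dim euclidean_metric B = ereal \<beta>" "\<beta> < 2 * \<alpha> - real k + e" "0 \<le> \<beta>"
        using hausdorff_dim_nonneg[of euclidean_metric B]
        by (cases "hausdorff_dim euclidean_metric B") auto
      define \<gamma> where "\<gamma> = (2 * \<alpha> - real k + e - \<beta>) / 4"
      define s where "s = max (\<alpha> - \<gamma>) (\<alpha> / 2)"
      define t where "t = max (e - \<gamma>) (e / 2)"
      define u where "u = \<beta> + \<gamma> / 2"
      have \<gamma>: "0 < \<gamma>" using \<beta> by (simp add: \<gamma>_def)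
      have s: "0 < s" "s < \<alpha>" "\<alpha> - \<gamma> \<le> s" using assms(3) \<gamma> by (auto simp: s_def)
      have t: "0 < t" "t < e" "e - \<gamma> \<le> t" using e0 \<gamma> by (auto simp: t_def)
      have u: "0 < u" "\<beta> < u" "u < 2 * s - real k + t"
        using s(3) t(3) \<beta>(3) \<gamma> unfolding u_def by (auto simp: \<gamma>_def field_simps)
      have "0 < ball_content euclidean_metric u B"
      proof (rule ball_content_lower_bound[OF assms(5,1) s(1) _ t(1) _ u(1,3) assms(7)])
        show "s \<le> real k" "t \<le> 1" using s(2) assms(4) t(2) e(3) by auto
        have "ereal t < min (hausdorff_dim \<rho> E) 1" using t(2) e(1) by simp
        then show "0 < ball_content \<rho> t E" by (intro ball_content_pos t(1)) simp
        fix P assume "P \<in> E"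
        then have "ereal s < hausdorff_dim euclidean_metric (P \<inter> B)"
          using s(2) by (intro less_le_trans[OF _ assms(8)]) simp_all
        then show "0 < ball_content euclidean_metric s (P \<inter> B)" by (rule ball_content_pos[OF s(1)])
      qed
      moreover have "ball_content euclidean_metric u B = 0"
        using \<beta>(1) u(2) by (intro ball_content_zero) simp
      ultimately show False by simp
    qed
  qed
  then show ?thesis using e(1) by simp
qed

end
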